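(* Let $n\ge 4$ be an even integer and let $u\in C^\infty(\mathbb{R}^n)$ be such that the conformal metric $g=e^{2u}|dx|^2$ on $\mathbb{R}^n$ (not assumed complete) has finite total Q-curvature, with Q-curvature $Q$. Suppose that the scalar curvature satisfies $R_g\ge 0$ near infinity. Then: (1) $$0\le\int_{\mathbb{R}^n}Qe^{nu}\,dx\le (n-1)!\,|\mathbb{S}^n|;$$ (2) $$\liminf_{|x|\to\infty}\frac{u(x)}{\log|x|}=-\frac{2}{(n-1)!\,|\mathbb{S}^n|}\int_{\mathbb{R}^n}Qe^{nu}\,dx.$$
   Context: For a smooth function $u$ on $\mathbb{R}^n$ ($n\ge4$ even) and $g=e^{2u}|dx|^2$ (with $|dx|^2$ the Euclidean metric), the Q-curvature $Q$ of $g$ is the function defined by $(-\Delta)^{n/2}u=Qe^{nu}$, where $\Delta$ is the Euclidean Laplacian. The metric has finite total Q-curvature if $Qe^{nu}\in L^1(\mathbb{R}^n)$. The scalar curvature of $g$ is $R_g=2(n-1)e^{-2u}\left(-\Delta u-\frac{n-2}{2}|\nabla u|^2\right)$. "Near infinity" means outside some compact set. $|\mathbb{S}^n|$ is the volume of the standard unit $n$-sphere. *)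

theory Defs
  imports "HOL-Analysis.Analysis"
begin

definition partial :: "'n::finite \<Rightarrow> (real^'n \<Rightarrow> real) \<Rightarrow> real^'n \<Rightarrow> real" where
  "partial i f x = frechet_derivative f (at x) (axis i 1)"

primrec Ck :: "nat \<Rightarrow> (real^'n::finite \<Rightarrow> real) \<Rightarrow> bool" where
  "Ck 0 f \<longleftrightarrow> continuous_on UNIV f"
| "Ck (Suc k) f \<longleftrightarrow> (\<forall>x. f differentiable (at x)) \<and> (\<forall>i. Ck k (partial i f))"

definition smooth :: "(real^'n::finite \<Rightarrow> real) \<Rightarrow> bool" where
  "smooth f \<longleftrightarrow> (\<forall>k. Ck k f)"

definition grad :: "(real^'n::finite \<Rightarrow> real) \<Rightarrow> real^'n \<Rightarrow> real^'n" where
  "grad f x = (\<chi> i. partial i f x)"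

definition laplacian :: "(real^'n::finite \<Rightarrow> real) \<Rightarrow> real^'n \<Rightarrow> real" where
  "laplacian f x = (\<Sum>i\<in>UNIV. partial i (partial i f) x)"

definition neg_laplacian :: "(real^'n::finite \<Rightarrow> real) \<Rightarrow> real^'n \<Rightarrow> real" where
  "neg_laplacian f x = - laplacian f x"

text \<open>
  In the definitions of \<open>Q_curvature\<close> and \<open>scalar_curvature\<close> the dimension is
  \<open>n = CARD('n)\<close> and \<open>u\<close> stands for the conformal metric \<open>e\<^bsup>2u\<^esup> |dx|\<^sup>2\<close>.
  The Q-curvature is the unique solution \<open>Q\<close> of
  \<open>(-\<Delta>)\<^bsup>n/2\<^esup> u = Q e\<^bsup>nu\<^esup>\<close>; it is meaningful for even \<open>n\<close> only.
\<close>

definition Q_curvature :: "(real^'n::finite \<Rightarrow> real) \<Rightarrow> real^'n \<Rightarrow> real" where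
  "Q_curvature u x = (neg_laplacian ^^ (CARD('n) div 2)) u x / exp (real CARD('n) * u x)"

lemma Q_curvature_eq:
  "(neg_laplacian ^^ (CARD('n) div 2)) u x = Q_curvature u x * exp (real CARD('n) * u x)"
  for u :: "real^'n::finite \<Rightarrow> real"
  by (simp add: Q_curvature_def)

definition scalar_curvature :: "(real^'n::finite \<Rightarrow> real) \<Rightarrow> real^'n \<Rightarrow> real" where
  "scalar_curvature u x =
     2 * (real CARD('n) - 1) * exp (- 2 * u x) *
       (- laplacian u x - (real CARD('n) - 2) / 2 * (norm (grad u x))\<^sup>2)"

text \<open>
  The libraries contain no surface measure. The area of a compact hypersurface \<open>S\<close> is taken to be
  its Minkowski content of codimension one, the limit of
  \<open>vol {x. dist(x, S) < \<epsilon>} / (2\<epsilon>)\<close> as \<open>\<epsilon> \<rightarrow> 0\<close>; for the sphere the limit exists and the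
  lemma \<open>hypersurface_area_unit_sphere\<close> confirms its classical value. The unit \<open>n\<close>-sphere is the
  unit sphere of \<open>(real^'n) \<times> real\<close>, whose product norm is the Euclidean one.
\<close>

definition hypersurface_area :: "'a::euclidean_space set \<Rightarrow> real" where
  "hypersurface_area S =
     Lim (at_right 0) (\<lambda>\<epsilon>. measure lborel {x. infdist x S < \<epsilon>} / (2 * \<epsilon>))"

lemma infdist_unit_sphere:
  fixes x :: "'a::euclidean_space"
  shows "infdist x (sphere 0 1) = \<bar>norm x - 1\<bar>"
proof (rule antisym)
  obtain b :: 'a where b: "b \<in> Basis" using nonempty_Basis by blast
  define y where "y = (if x = 0 then b else x /\<^sub>R norm x)"
  have y: "y \<in> sphere 0 1" using b by (auto simp: y_def)
  have "dist x y = \<bar>norm x - 1\<bar>"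
  proof (cases "x = 0")
    case True then show ?thesis using b by (simp add: y_def)
  next
    case False
    have "x - y = (norm x - 1) *\<^sub>R (x /\<^sub>R norm x)"
      using False by (simp add: y_def algebra_simps)
    then show ?thesis using False by (simp add: dist_norm abs_mult)
  qed
  then show "infdist x (sphere 0 1) \<le> \<bar>norm x - 1\<bar>"
    using infdist_le[OF y, of x] by simp
  have ne: "sphere (0::'a) 1 \<noteq> {}" using y by blast
  show "\<bar>norm x - 1\<bar> \<le> infdist x (sphere 0 1)"
    unfolding infdist_notempty[OF ne]
  proof (rule cINF_greatest[OF ne])
    fix z :: 'a assume "z \<in> sphere 0 1"
    then show "\<bar>norm x - 1\<bar> \<le> dist x z"
      using norm_triangle_ineq3[of x z] by (simp add: dist_norm)
  qed
qed

lemma hypersurface_area_unit_sphere: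
  "hypersurface_area (sphere (0::'a::euclidean_space) 1) = DIM('a) * unit_ball_vol DIM('a)"
proof -
  let ?m = "DIM('a)"
  let ?g = "\<lambda>e::real. (1 + e) ^ ?m - (1 - e) ^ ?m"
  let ?F = "\<lambda>e. measure lborel {x::'a. infdist x (sphere 0 1) < e} / (2 * e)"
  have vol: "measure lborel {x::'a. infdist x (sphere 0 1) < e} = unit_ball_vol ?m * ?g e"
    if e: "0 < e" "e < 1" for e
  proof -
    have eq: "{x::'a. infdist x (sphere 0 1) < e} = ball 0 (1 + e) - cball 0 (1 - e)"
      by (auto simp: infdist_unit_sphere)
    have "measure lborel (ball (0::'a) (1 + e) - cball 0 (1 - e))
        = measure lborel (ball (0::'a) (1 + e)) - measure lborel (cball (0::'a) (1 - e))"
      by (rule measure_Diff) (use e emeasure_lborel_ball_finite[of \<open>0::'a\<close> \<open>1 + e\<close>] in \<open>auto simp: less_top\<close>)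
    also have "\<dots> = unit_ball_vol ?m * (1 + e) ^ ?m - unit_ball_vol ?m * (1 - e) ^ ?m"
      using e by (simp add: content_ball content_cball)
    finally show ?thesis by (simp add: eq algebra_simps)
  qed
  have "(?g has_field_derivative 2 * real ?m) (at 0)"
    by (auto intro!: derivative_eq_intros)
  then have "((\<lambda>e. ?g e / e) \<longlongrightarrow> 2 * real ?m) (at 0)"
    by (simp add: DERIV_def)
  then have "((\<lambda>e. ?g e / e) \<longlongrightarrow> 2 * real ?m) (at_right 0)"
    by (rule filterlim_mono[OF _ order_refl at_le]) simp
  then have "((\<lambda>e. unit_ball_vol ?m / 2 * (?g e / e)) \<longlongrightarrow> unit_ball_vol ?m / 2 * (2 * real ?m))
      (at_right 0)"
    by (rule tendsto_mult_left)
  then have lim: "((\<lambda>e. unit_ball_vol ?m / 2 * (?g e / e)) \<longlongrightarrow> ?m * unit_ball_vol ?m) (at_right 0)"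
    by (simp add: mult.commute)
  have ev: "\<forall>\<^sub>F e in at_right 0. unit_ball_vol ?m / 2 * (?g e / e) = ?F e"
  proof (rule eventually_mono[OF eventually_at_right_real[OF zero_less_one]])
    fix e :: real assume "e \<in> {0<..<1}"
    then show "unit_ball_vol ?m / 2 * (?g e / e) = ?F e" by (simp add: vol)
  qed
  have "(?F \<longlongrightarrow> ?m * unit_ball_vol ?m) (at_right 0)"
    by (rule Lim_transform_eventually[OF lim ev])
  then show ?thesis
    unfolding hypersurface_area_def by (intro tendsto_Lim) auto
qed

corollary hypersurface_area_unit_sphere_Gamma:
  "hypersurface_area (sphere (0 :: (real^'n::finite) \<times> real) 1) =
     2 * pi powr ((real CARD('n) + 1) / 2) / Gamma ((real CARD('n) + 1) / 2)"
proof -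
  define s where "s = (real CARD('n) + 1) / 2"
  have "s > 0" by (simp add: s_def add_pos_pos)
  then have G: "Gamma (s + 1) = s * Gamma s"
    by (intro Gamma_plus1) (auto simp: nonpos_Ints_def)
  have d: "real DIM((real^'n) \<times> real) = 2 * s" by (simp add: s_def)
  show ?thesis
    unfolding hypersurface_area_unit_sphere d s_def[symmetric] unit_ball_vol_def
    using G \<open>s > 0\<close> by simp
qed

end

theory Submission
  imports Defs "HOL-Real_Asymp.Real_Asymp"
begin

text \<open>
  Write \<open>n = 2m\<close> and let \<open>A(s)\<close> be the average of \<open>u\<close> over the ball \<open>|x|\<^sup>2 < s\<close> with weight
  \<open>(s - |x|\<^sup>2)\<^sup>2 / 2\<close>. Differentiating such an average in \<open>s\<close> replaces \<open>u\<close> by a quarter of its Laplacian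
  and raises the exponent of the weight by one, so the \<open>m\<close>-th derivative of \<open>A\<close> is an average of
  \<open>(-\<Delta>)\<^sup>m u\<close>, which is asymptotic to a constant times \<open>s\<^bsup>-m\<^esup>\<close> because \<open>(-\<Delta>)\<^sup>m u\<close> is integrable. Integrating
  back, either \<open>s A'(s)\<close> tends to an explicit negative multiple of the total Q-curvature, or \<open>A'\<close> grows
  like a polynomial. Nonnegative scalar curvature bounds the Dirichlet energy of \<open>u\<close> on balls
  linearly by \<open>A'\<close>, while \<open>A'\<close> is itself bounded by the square root of that energy; this excludes
  the polynomial case. Hence \<open>A(s)\<close> behaves like \<open>-\<theta> log s\<close>, and \<open>\<theta> \<ge> 0\<close> since \<open>u\<close> is superharmonic near
  infinity.

  The resulting energy bound also shows that the average around \<open>x\<close> at scale \<open>|x|/2\<close> differs from the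
  one around the origin by a bounded amount. Superharmonicity gives \<open>u(x)\<close> at least this average up
  to a constant, and a lower bound \<open>u \<ge> \<beta> log|x|\<close> passes to the averages, which determines the lower
  limit. Finally \<open>exp((m - 1)u)\<close> is superharmonic near infinity, so by the minimum principle it decays no faster
  than \<open>|x|\<^bsup>-2b\<^esup>\<close> for every \<open>b > m - 1\<close>, which yields the upper bound on the total curvature.
\<close>

section \<open>Integrals of compactly supported functions and their parameter derivatives\<close>

lemma lborel_integral_continuous_cbox:
  fixes f :: "'a::euclidean_space \<Rightarrow> real"
  assumes "continuous_on (cbox a b) f" and "\<And>x. x \<notin> cbox a b \<Longrightarrow> f x = 0"
  shows "integrable lborel f" and "(LINT x|lborel. f x) = integral (cbox a b) f"
proof -
  have eq: "(\<lambda>x. indicator (cbox a b) x *\<^sub>R f x) = f"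
    using assms(2) by (auto simp: fun_eq_iff indicator_def)
  have i: "set_integrable lborel (cbox a b) f"
    unfolding set_integrable_def by (intro borel_integrable_compact assms compact_cbox)
  then show "integrable lborel f"
    unfolding set_integrable_def eq .
  show "(LINT x|lborel. f x) = integral (cbox a b) f"
    using set_borel_integral_eq_integral(2)[OF i]
    unfolding set_lebesgue_integral_def eq .
qed

text \<open>The common support box turns the Lebesgue integrals into integrals over a compact box,
  where the Leibniz rule for jointly continuous derivatives applies.\<close>

lemma lborel_integral_leibniz:
  fixes F F' :: "real \<Rightarrow> 'a::euclidean_space \<Rightarrow> real"
  assumes "open U" "convex U" "t0 \<in> U"
    and der: "\<And>t x. t \<in> U \<Longrightarrow> ((\<lambda>t. F t x) has_real_derivative F' t x) (at t)"
    and contF: "\<And>t. t \<in> U \<Longrightarrow> continuous_on UNIV (F t)"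
    and contF': "continuous_on (U \<times> UNIV) (\<lambda>(t, x). F' t x)"
    and supp: "\<And>t x. t \<in> U \<Longrightarrow> x \<notin> cbox a b \<Longrightarrow> F t x = 0"
  shows "((\<lambda>t. LINT x|lborel. F t x) has_real_derivative (LINT x|lborel. F' t0 x)) (at t0)"
proof -
  \<comment> \<open>Outside the box the function of t is zero on the open set \<open>U\<close>, so
    its derivative vanishes there and both integrals live on the same box.\<close>
  have supp': "F' t x = 0" if t: "t \<in> U" and x: "x \<notin> cbox a b" for t x
  proof -
    have "((\<lambda>t. F t x) has_real_derivative 0) (at t)"
      by (rule has_field_derivative_transform_within_open[of "\<lambda>_. 0" 0 t U])
        (use assms(1) t supp x in auto)
    then show ?thesis
      using der[OF t, of x] DERIV_unique by blast
  qed
  have contF't: "continuous_on UNIV (F' t)" if "t \<in> U" for t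
    using continuous_on_compose2[OF contF' continuous_on_Pair[OF continuous_on_const continuous_on_id],
        of t UNIV] that by auto
  have eq: "(LINT x|lborel. F t x) = integral (cbox a b) (F t)"
    and eq': "(LINT x|lborel. F' t x) = integral (cbox a b) (F' t)" if "t \<in> U" for t
    using that contF contF't supp supp'
    by (intro lborel_integral_continuous_cbox(2); blast intro: continuous_on_subset)+
  have "((\<lambda>t. integral (cbox a b) (F t)) has_real_derivative integral (cbox a b) (F' t0)) (at t0 within U)"
  proof (rule leibniz_rule_field_derivative)
    show "\<And>x t. x \<in> U \<Longrightarrow> t \<in> cbox a b \<Longrightarrow> ((\<lambda>x. F x t) has_real_derivative F' x t) (at x within U)"
      using der has_field_derivative_at_within by blast
    show "\<And>x. x \<in> U \<Longrightarrow> F x integrable_on cbox a b"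
      using contF by (intro integrable_continuous) (blast intro: continuous_on_subset)
    show "continuous_on (U \<times> cbox a b) (\<lambda>(x, t). F' x t)"
      using contF' by (rule continuous_on_subset) auto
  qed (use assms in auto)
  then have "((\<lambda>t. integral (cbox a b) (F t)) has_real_derivative integral (cbox a b) (F' t0)) (at t0)"
    using assms at_within_open by metis
  then have "((\<lambda>t. LINT x|lborel. F t x) has_real_derivative integral (cbox a b) (F' t0)) (at t0)"
    by (rule has_field_derivative_transform_within_open[OF _ assms(1,3)]) (simp add: eq)
  then show ?thesis by (simp add: eq' assms(3))
qed

lemma lborel_integral_translate:
  fixes f :: "'a::euclidean_space \<Rightarrow> real"
  assumes "f \<in> borel_measurable borel"
  shows "(LINT x|lborel. f (c + x)) = (LINT x|lborel. f x)"
proof -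
  have "(LINT x|lborel. f x) = (LINT x|distr lborel borel (\<lambda>x. c + x). f x)"
    by (simp add: lborel_distr_plus)
  also have "\<dots> = (LINT x|lborel. f (c + x))"
    by (rule integral_distr) (use assms in auto)
  finally show ?thesis by simp
qed

text \<open>The translates of \<open>G\<close> along \<open>e\<close> all have the same integral, so its derivative vanishes.\<close>

lemma lborel_integral_directional_derivative_eq_0:
  fixes G G' :: "'a::euclidean_space \<Rightarrow> real"
  assumes der: "\<And>x. ((\<lambda>t. G (x + t *\<^sub>R e)) has_real_derivative G' x) (at 0)"
    and cont: "continuous_on UNIV G" "continuous_on UNIV G'"
    and supp: "\<And>x. norm x > r \<Longrightarrow> G x = 0"
  shows "(LINT x|lborel. G' x) = 0"
proof -
  \<comment> \<open>The extra \<open>norm e\<close> makes the box contain the supports of all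
    translates with parameter in (-1, 1).\<close>
  obtain a where a: "cball (0::'a) (\<bar>r\<bar> + norm e) \<subseteq> cbox (-a) a"
    using bounded_subset_cbox_symmetric[OF bounded_cball] by blast
  have der': "((\<lambda>t. G (x + t *\<^sub>R e)) has_real_derivative G' (x + t *\<^sub>R e)) (at t)" for x t
  proof -
    have "((\<lambda>s. G (x + t *\<^sub>R e + s *\<^sub>R e)) has_real_derivative G' (x + t *\<^sub>R e)) (at 0)"
      by (rule der)
    then have "((\<lambda>s. G (x + (s + t) *\<^sub>R e)) has_real_derivative G' (x + t *\<^sub>R e)) (at 0)"
      by (simp add: algebra_simps)
    then show ?thesis
      using DERIV_shift[of "\<lambda>s. G (x + s *\<^sub>R e)" _ 0 t] by simp
  qed
  have "((\<lambda>t. LINT x|lborel. G (x + t *\<^sub>R e)) has_real_derivative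
      (LINT x|lborel. G' (x + 0 *\<^sub>R e))) (at 0)"
  proof (rule lborel_integral_leibniz[of "{-1<..<1::real}" _ _ _ "-a" a])
    show "continuous_on ({- 1<..<1} \<times> UNIV) (\<lambda>(t, x). G' (x + t *\<^sub>R e))"
      unfolding case_prod_beta
      by (rule continuous_on_compose2[OF cont(2)]) (auto intro!: continuous_intros)
    show "continuous_on UNIV (\<lambda>x. G (x + t *\<^sub>R e))" for t
      by (rule continuous_on_compose2[OF cont(1)]) (auto intro!: continuous_intros)
    fix t x assume t: "t \<in> {- 1<..<1::real}" and x: "x \<notin> cbox (- a) a"
    have "norm x > \<bar>r\<bar> + norm e" using x a by (meson linorder_not_le mem_cball_0 subsetD)
    moreover have "norm (t *\<^sub>R e) \<le> norm e"
      using t mult_right_mono[of "\<bar>t\<bar>" 1 "norm e"] by auto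
    moreover have "norm x - norm (t *\<^sub>R e) \<le> norm (x + t *\<^sub>R e)"
      using norm_triangle_ineq4[of "x + t *\<^sub>R e" "t *\<^sub>R e"] by simp
    ultimately show "G (x + t *\<^sub>R e) = 0" by (intro supp) linarith
  qed (use der' in auto)
  moreover have "(LINT x|lborel. G (x + t *\<^sub>R e)) = (LINT x|lborel. G x)" for t
    using lborel_integral_translate[of G "t *\<^sub>R e"] cont(1)
    by (simp add: add.commute borel_measurable_continuous_onI)
  ultimately have "((\<lambda>t::real. LINT x|lborel. G x) has_real_derivative (LINT x|lborel. G' x)) (at 0)"
    by simp
  then show ?thesis using DERIV_unique DERIV_const by blast
qed

subsection \<open>Weighted averages over balls\<close>

text \<open>The parameter s is a squared radius, and the factor 1/k! makes differentiation in s
  lower k by one without a constant. For k = 0 the convention 0^0 = 1 gives the constant 1 and not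
  the indicator of a ball, hence the recurring conditions \<open>k > 0\<close> and, for derivatives,
  \<open>k \<ge> 2\<close>.\<close>

definition weight :: "nat \<Rightarrow> real \<Rightarrow> 'a::real_inner \<Rightarrow> real" where
  "weight k s x = max 0 (s - x \<bullet> x) ^ k / fact k"

lemma DERIV_max0_power:
  "((\<lambda>t::real. max 0 t ^ Suc (Suc k)) has_real_derivative real (Suc (Suc k)) * max 0 t ^ Suc k) (at t)"
proof -
  consider "t > 0" | "t < 0" | "t = 0" by linarith
  then show ?thesis
  proof cases
    case 1
    have "((\<lambda>t::real. t ^ Suc (Suc k)) has_real_derivative real (Suc (Suc k)) * t ^ Suc k) (at t)"
      using DERIV_pow[of "Suc (Suc k)" t] by simp
    then have "((\<lambda>t::real. max 0 t ^ Suc (Suc k)) has_real_derivative real (Suc (Suc k)) * t ^ Suc k) (at t)"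
      by (rule has_field_derivative_transform_within_open[of _ _ _ "{0<..}"]) (use 1 in \<open>auto simp: max_def\<close>)
    then show ?thesis using 1 by simp
  next
    case 2
    have "((\<lambda>t::real. max 0 t ^ Suc (Suc k)) has_real_derivative 0) (at t)"
      by (rule has_field_derivative_transform_within_open[of "\<lambda>_. 0" _ _ "{..<0}"])
         (use 2 in \<open>auto simp: max_def\<close>)
    then show ?thesis using 2 by (simp add: max_def)
  next
    case 3
    \<comment> \<open>At the kink the difference quotient is a positive power of the truncation,
      which tends to 0, times a quotient with values in [0, 1].\<close>
    have "((\<lambda>h::real. max 0 h ^ Suc k * (max 0 h / h)) \<longlongrightarrow> 0) (at 0)"
    proof (rule Lim_null_comparison)
      show "\<forall>\<^sub>F h in at 0. norm (max 0 h ^ Suc k * (max 0 h / h)) \<le> max 0 h ^ Suc k" for k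
        by (rule always_eventually) (auto simp: max_def)
      have "isCont (\<lambda>h::real. max 0 h ^ Suc k) 0" by (intro continuous_intros)
      then show "((\<lambda>h::real. max 0 h ^ Suc k) \<longlongrightarrow> 0) (at 0)" by (simp add: isCont_def)
    qed
    then show ?thesis using 3 by (simp add: DERIV_def mult_ac)
  qed
qed

lemma DERIV_max0_power_div_fact:
  "k \<ge> 2 \<Longrightarrow> ((\<lambda>t::real. max 0 t ^ k / fact k) has_real_derivative max 0 t ^ (k - 1) / fact (k - 1)) (at t)"
proof -
  assume "k \<ge> 2"
  then obtain j where k: "k = Suc (Suc j)" by (metis add_2_eq_Suc le_Suc_ex)
  have "((\<lambda>t::real. max 0 t ^ k / fact k) has_real_derivative (real k * max 0 t ^ Suc j) / fact k) (at t)"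
    unfolding k by (rule DERIV_cdivide[OF DERIV_max0_power])
  moreover have "(real k * max 0 t ^ Suc j) / fact k = max 0 t ^ (k - 1) / fact (k - 1)"
    by (simp add: k fact_Suc del: of_nat_Suc)
  ultimately show ?thesis by simp
qed

lemma weight_nonneg [simp]: "weight k s x \<ge> 0"
  by (simp add: weight_def)

lemma weight_eq_0: "k > 0 \<Longrightarrow> s \<le> x \<bullet> x \<Longrightarrow> weight k s x = 0"
  by (simp add: weight_def max_def zero_power)

lemma continuous_on_weight [continuous_intros]:
  "continuous_on A f \<Longrightarrow> continuous_on A g \<Longrightarrow> continuous_on A (\<lambda>x. weight k (f x) (g x))"
  unfolding weight_def by (intro continuous_intros) auto

lemma weight_le: "s \<ge> 0 \<Longrightarrow> weight k s x \<le> s ^ k / fact k"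
  unfolding weight_def by (intro divide_right_mono power_mono) auto

lemma DERIV_weight:
  assumes "k \<ge> 2"
  shows "((\<lambda>s. weight k s x) has_real_derivative weight (k - 1) s x) (at s)"
proof -
  have "((\<lambda>s. s - x \<bullet> x) has_real_derivative 1) (at s)"
    by (auto intro!: derivative_eq_intros)
  from DERIV_chain2[OF DERIV_max0_power_div_fact[OF assms] this] show ?thesis
    by (simp add: weight_def)
qed

lemma DERIV_weight_line:
  assumes "k \<ge> 2"
  shows "((\<lambda>t. weight k s (x + t *\<^sub>R e)) has_real_derivative - 2 * (x \<bullet> e) * weight (k - 1) s x) (at 0)"
proof -
  have "((\<lambda>t. s - (x + t *\<^sub>R e) \<bullet> (x + t *\<^sub>R e)) has_real_derivative - 2 * (x \<bullet> e)) (at 0)"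
    by (simp only: inner_add_left inner_add_right inner_scaleR_left inner_scaleR_right)
      (auto intro!: derivative_eq_intros simp: inner_commute)
  from DERIV_chain2[OF DERIV_max0_power_div_fact[OF assms] this]
  show ?thesis by (simp add: weight_def mult_ac)
qed

text \<open>A factor s - |x|^2 is absorbed by the weight as one more exponent. This removes the
  factor |x|^2 that integration by parts produces.\<close>

lemma weight_recursion:
  assumes "k \<ge> 2"
  shows "(x \<bullet> x) * weight (k - 1) s x = s * weight (k - 1) s x - real k * weight k s x"
proof -
  obtain j where k: "k = Suc (Suc j)" using assms by (metis add_2_eq_Suc le_Suc_ex)
  have "real k * weight k s x = max 0 (s - x \<bullet> x) * weight (k - 1) s x"
    by (simp add: weight_def k fact_Suc del: of_nat_Suc)
  also have "\<dots> = (s - x \<bullet> x) * weight (k - 1) s x"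
    by (auto simp: weight_def k max_def)
  finally show ?thesis by (simp add: algebra_simps)
qed

lemma norm_gt_imp_weight_eq_0: "k > 0 \<Longrightarrow> norm x > sqrt \<bar>s\<bar> \<Longrightarrow> weight k s x = 0"
proof -
  assume "k > 0" and "norm x > sqrt \<bar>s\<bar>"
  then have "(sqrt \<bar>s\<bar>)\<^sup>2 \<le> (norm x)\<^sup>2" by (intro power_mono) auto
  then have "s \<le> x \<bullet> x" by (simp add: power2_norm_eq_inner)
  with \<open>k > 0\<close> show ?thesis by (rule weight_eq_0)
qed

lemma integrable_weight:
  fixes h :: "'a::euclidean_space \<Rightarrow> real"
  assumes "continuous_on UNIV h" "k > 0"
  shows "integrable lborel (\<lambda>x. h x * weight k s x)"
proof -
  obtain a where a: "cball (0::'a) (sqrt \<bar>s\<bar>) \<subseteq> cbox (-a) a"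
    using bounded_subset_cbox_symmetric[OF bounded_cball] by blast
  show ?thesis
  proof (rule lborel_integral_continuous_cbox(1)[of "-a" a])
    show "continuous_on (cbox (- a) a) (\<lambda>x. h x * weight k s x)"
      by (intro continuous_intros continuous_on_subset[OF assms(1)]) auto
    fix x assume "x \<notin> cbox (- a) a"
    then have "norm x > sqrt \<bar>s\<bar>" using a by (meson linorder_not_le mem_cball_0 subsetD)
    then show "h x * weight k s x = 0" using norm_gt_imp_weight_eq_0 assms by auto
  qed
qed

definition wint :: "nat \<Rightarrow> ('a::euclidean_space \<Rightarrow> real) \<Rightarrow> real \<Rightarrow> real" where
  "wint k h s = (LINT x|lborel. h x * weight k s x)"

lemma DERIV_wint:
  fixes h :: "'a::euclidean_space \<Rightarrow> real"
  assumes h: "continuous_on UNIV h" and k: "k \<ge> 2"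
  shows "(wint k h has_real_derivative wint (k - 1) h s) (at s)"
proof -
  \<comment> \<open>This radius covers the supports for all parameters within distance 1 of
    s.\<close>
  obtain a where a: "cball (0::'a) (sqrt (\<bar>s\<bar> + 1)) \<subseteq> cbox (-a) a"
    using bounded_subset_cbox_symmetric[OF bounded_cball] by blast
  have "((\<lambda>t. LINT x|lborel. h x * weight k t x) has_real_derivative (LINT x|lborel. h x * weight (k - 1) s x)) (at s)"
  proof (rule lborel_integral_leibniz[of "{s - 1<..<s + 1}" _ _ _ "-a" a])
    show "((\<lambda>t. h x * weight k t x) has_real_derivative h x * weight (k - 1) t x) (at t)" for t x
      by (intro DERIV_cmult DERIV_weight k)
    show "continuous_on UNIV (\<lambda>x. h x * weight k t x)" for t
      by (intro continuous_intros h)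
    show "continuous_on ({s - 1<..<s + 1} \<times> UNIV) (\<lambda>(t, x). h x * weight (k - 1) t x)"
      unfolding case_prod_beta
      by (intro continuous_intros continuous_on_compose2[OF h]) auto
    fix t x assume t: "t \<in> {s - 1<..<s + 1}" and x: "x \<notin> cbox (- a) a"
    have "sqrt \<bar>t\<bar> \<le> sqrt (\<bar>s\<bar> + 1)" using t by (auto simp: abs_if)
    moreover have "norm x > sqrt (\<bar>s\<bar> + 1)" using x a by (meson linorder_not_le mem_cball_0 subsetD)
    ultimately have "sqrt \<bar>t\<bar> < norm x" by linarith
    then show "h x * weight k t x = 0" using norm_gt_imp_weight_eq_0[of k t x] k by auto
  qed auto
  then show ?thesis by (simp add: wint_def[abs_def])
qed

section \<open>Partial derivatives, gradients and smooth functions\<close>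

lemma has_derivative_grad:
  fixes f :: "real^'n::finite \<Rightarrow> real"
  assumes "f differentiable (at x)"
  shows "(f has_derivative (\<lambda>h. h \<bullet> grad f x)) (at x)"
proof -
  let ?D = "frechet_derivative f (at x)"
  have D: "(f has_derivative ?D) (at x)" using assms frechet_derivative_works by blast
  then have lin: "linear ?D" by (rule has_derivative_linear)
  have "?D h = h \<bullet> grad f x" for h
  proof -
    have "?D h = ?D (\<Sum>i\<in>UNIV. h $ i *\<^sub>R axis i 1)"
      by (simp add: basis_expansion[of h, unfolded scalar_mult_eq_scaleR])
    also have "\<dots> = (\<Sum>i\<in>UNIV. h $ i * partial i f x)"
      by (simp add: linear_sum[OF lin] linear_scale[OF lin] partial_def)
    finally show ?thesis by (simp add: inner_vec_def grad_def)
  qed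
  then show ?thesis using D by (metis (no_types, lifting) ext)
qed

lemma partial_eqI:
  fixes f :: "real^'n::finite \<Rightarrow> real"
  assumes "(f has_derivative D) (at x)"
  shows "partial i f x = D (axis i 1)"
  using frechet_derivative_at[OF assms] by (simp add: partial_def)

lemma DERIV_line:
  fixes f :: "real^'n::finite \<Rightarrow> real"
  assumes "f differentiable (at (x + t *\<^sub>R e))"
  shows "((\<lambda>t. f (x + t *\<^sub>R e)) has_real_derivative e \<bullet> grad f (x + t *\<^sub>R e)) (at t)"
proof -
  have "((\<lambda>t. x + t *\<^sub>R e) has_derivative (\<lambda>h. h *\<^sub>R e)) (at t)"
    by (auto intro!: derivative_eq_intros)
  from has_derivative_compose[OF this has_derivative_grad[OF assms]] show ?thesis
    by (simp add: has_field_derivative_def mult_commute_abs)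
qed

lemma inner_axis_grad [simp]: "axis i 1 \<bullet> grad f x = partial i f x"
  by (simp add: grad_def inner_axis' )

lemma DERIV_line_axis:
  fixes f :: "real^'n::finite \<Rightarrow> real"
  assumes "f differentiable (at x)"
  shows "((\<lambda>t. f (x + t *\<^sub>R axis i 1)) has_real_derivative partial i f x) (at 0)"
  using DERIV_line[of f x 0 "axis i 1"] assms by simp

lemma Ck_continuous: "Ck k f \<Longrightarrow> continuous_on UNIV f"
  by (cases k) (auto simp: differentiable_imp_continuous_within continuous_at_imp_continuous_on)

lemma smooth_continuous: "smooth f \<Longrightarrow> continuous_on UNIV f"
  using Ck_continuous smooth_def by blast

lemma smooth_differentiable: "smooth f \<Longrightarrow> f differentiable (at x)"
  unfolding smooth_def using Ck.simps(2) by blast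

lemma smooth_partial: "smooth f \<Longrightarrow> smooth (partial i f)"
  unfolding smooth_def using Ck.simps(2) by blast

lemma smooth_grad_continuous: "smooth f \<Longrightarrow> continuous_on UNIV (grad f)"
  unfolding grad_def
  by (intro continuous_on_vec_lambda smooth_continuous smooth_partial)

lemma partial_add:
  assumes "f differentiable (at x)" "g differentiable (at x)"
  shows "partial i (\<lambda>x. f x + g x) x = partial i f x + partial i g x"
  using partial_eqI[OF has_derivative_add[OF has_derivative_grad[OF assms(1)] has_derivative_grad[OF assms(2)]]]
  by simp

lemma partial_uminus:
  assumes "f differentiable (at x)"
  shows "partial i (\<lambda>x. - f x) x = - partial i f x"
  using partial_eqI[OF has_derivative_minus[OF has_derivative_grad[OF assms(1)]]]
  by simp

lemma partial_translate:
  assumes "f differentiable (at (c + x))"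
  shows "partial i (\<lambda>x. f (c + x)) x = partial i f (c + x)"
proof -
  have "((\<lambda>x. c + x) has_derivative (\<lambda>h. h)) (at x)" by (auto intro!: derivative_eq_intros)
  from partial_eqI[OF has_derivative_compose[OF this has_derivative_grad[OF assms]]]
  show ?thesis by simp
qed

lemma Ck_add: "Ck k f \<Longrightarrow> Ck k g \<Longrightarrow> Ck k (\<lambda>x. f x + g x)"
proof (induction k arbitrary: f g)
  case 0 then show ?case by (auto intro: continuous_intros)
next
  case (Suc k)
  then have "partial i (\<lambda>x. f x + g x) = (\<lambda>x. partial i f x + partial i g x)" for i
    by (intro ext partial_add) auto
  with Suc show ?case by auto
qed

lemma Ck_uminus: "Ck k f \<Longrightarrow> Ck k (\<lambda>x. - f x)"
proof (induction k arbitrary: f)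
  case 0 then show ?case by (auto intro: continuous_intros)
next
  case (Suc k)
  then have "partial i (\<lambda>x. - f x) = (\<lambda>x. - partial i f x)" for i
    by (intro ext partial_uminus) auto
  with Suc show ?case by auto
qed

lemma Ck_translate: "Ck k f \<Longrightarrow> Ck k (\<lambda>x. f (c + x))"
proof (induction k arbitrary: f)
  case 0 then show ?case by (auto intro!: continuous_on_compose2[of UNIV f] continuous_intros)
next
  case (Suc k)
  have "(\<lambda>x. f (c + x)) differentiable (at x)" for x
    using differentiable_chain_at[of "\<lambda>x. c + x" x f] Suc.prems by (auto simp: o_def)
  moreover have "partial i (\<lambda>x. f (c + x)) = (\<lambda>x. partial i f (c + x))" for i
    using Suc.prems by (intro ext partial_translate) auto
  ultimately show ?case using Suc by auto
qed

lemma Ck_const: "Ck k (\<lambda>x::real^'n::finite. c)"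
proof (induction k arbitrary: c)
  case (Suc k)
  have "partial i (\<lambda>x::real^'n. c) = (\<lambda>x. 0)" for i
    using partial_eqI[OF has_derivative_const] by (intro ext) auto
  with Suc show ?case by simp
qed simp

lemma smooth_sum: "finite A \<Longrightarrow> (\<And>i. i \<in> A \<Longrightarrow> smooth (f i)) \<Longrightarrow> smooth (\<lambda>x. \<Sum>i\<in>A. f i x)"
  by (induction A rule: finite_induct) (auto simp: smooth_def Ck_const Ck_add)

lemma smooth_laplacian: "smooth f \<Longrightarrow> smooth (laplacian f)"
  unfolding laplacian_def[abs_def] by (intro smooth_sum smooth_partial) auto

lemma smooth_neg_laplacian: "smooth f \<Longrightarrow> smooth (neg_laplacian f)"
  using smooth_laplacian[of f] Ck_uminus unfolding neg_laplacian_def[abs_def] smooth_def by blast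

lemma smooth_neg_laplacian_iter: "smooth f \<Longrightarrow> smooth ((neg_laplacian ^^ k) f)"
  by (induction k) (auto intro: smooth_neg_laplacian)

lemma smooth_translate: "smooth f \<Longrightarrow> smooth (\<lambda>x. f (c + x))"
  using Ck_translate unfolding smooth_def by blast

lemma laplacian_translate: "smooth f \<Longrightarrow> laplacian (\<lambda>x. f (c + x)) x = laplacian f (c + x)"
proof -
  assume f: "smooth f"
  have "partial i (\<lambda>x. f (c + x)) = (\<lambda>x. partial i f (c + x))" for i
    by (intro ext partial_translate smooth_differentiable f)
  then show ?thesis
    by (simp add: laplacian_def partial_translate smooth_differentiable smooth_partial f)
qed

section \<open>Integration by parts against the weights\<close>

lemma inner_grad_eq_sum:
  "(x \<bullet> grad u x) * c = (\<Sum>i\<in>UNIV. (partial i u x * x $ i) * c)"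
  by (simp add: inner_vec_def grad_def sum_distrib_right sum_distrib_left mult_ac)

text \<open>The divergence of the compactly supported field \<open>weight (k + 1) s x\<close> times
  the gradient of u integrates to zero, and the gradient of \<open>weight (k + 1) s\<close> is -2x
  \<open>weight k s\<close>. The argument runs coordinate by coordinate.\<close>

lemma wint_laplacian:
  fixes u :: "real^'n::finite \<Rightarrow> real"
  assumes u: "smooth u" and k: "k \<ge> 2"
  shows "wint (k + 1) (laplacian u) s = 2 * (LINT x|lborel. (x \<bullet> grad u x) * weight k s x)"
proof -
  have c1: "continuous_on UNIV (partial i u)" and c2: "continuous_on UNIV (partial i (partial i u))" for i
    using u smooth_continuous smooth_partial by blast+
  have int1: "integrable lborel (\<lambda>x. partial i (partial i u) x * weight (k + 1) s x)" for i
    by (intro integrable_weight c2) auto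
  have int2: "integrable lborel (\<lambda>x. (partial i u x * x $ i) * weight k s x)" for i
    using k by (intro integrable_weight continuous_intros c1) auto
  have "(LINT x|lborel. partial i (partial i u) x * weight (k + 1) s x - 2 * ((partial i u x * x $ i) * weight k s x)) = 0" for i
  proof (rule lborel_integral_directional_derivative_eq_0
      [where e = "axis i 1" and G = "\<lambda>x. partial i u x * weight (k + 1) s x" and r = "sqrt \<bar>s\<bar>"])
    show "((\<lambda>t. partial i u (x + t *\<^sub>R axis i 1) * weight (k + 1) s (x + t *\<^sub>R axis i 1)) has_real_derivative
        partial i (partial i u) x * weight (k + 1) s x - 2 * ((partial i u x * x $ i) * weight k s x)) (at 0)" for x
      by (rule derivative_eq_intros DERIV_line_axis[OF smooth_differentiable[OF smooth_partial[OF u]]]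
            DERIV_weight_line)+ (use k in \<open>auto simp: inner_axis algebra_simps\<close>)
    show "continuous_on UNIV (\<lambda>x. partial i u x * weight (k + 1) s x)"
      by (intro continuous_intros c1)
    show "continuous_on UNIV (\<lambda>x. partial i (partial i u) x * weight (k + 1) s x - 2 * ((partial i u x * x $ i) * weight k s x))"
      by (intro continuous_intros c1 c2)
  qed (simp add: norm_gt_imp_weight_eq_0)
  then have eq: "(LINT x|lborel. partial i (partial i u) x * weight (k + 1) s x)
      = 2 * (LINT x|lborel. (partial i u x * x $ i) * weight k s x)" for i
    using int1 int2 by (simp add: Bochner_Integration.integral_diff)
  have "wint (k + 1) (laplacian u) s = (\<Sum>i\<in>UNIV. LINT x|lborel. partial i (partial i u) x * weight (k + 1) s x)"
    using int1 by (simp add: wint_def laplacian_def sum_distrib_right)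
  also have "\<dots> = 2 * (\<Sum>i\<in>UNIV. LINT x|lborel. (partial i u x * x $ i) * weight k s x)"
    unfolding eq sum_distrib_left ..
  also have "(\<Sum>i\<in>UNIV. LINT x|lborel. (partial i u x * x $ i) * weight k s x)
      = (LINT x|lborel. (x \<bullet> grad u x) * weight k s x)"
    unfolding inner_grad_eq_sum by (rule Bochner_Integration.integral_sum[symmetric]) (rule int2)
  finally show ?thesis .
qed

text \<open>Here the field is u(x) x \<open>weight k s x\<close>. Its divergence consists of the
  radial derivative, n copies of u from the divergence of x, and -2|x|^2 u with the exponent
  lowered; \<open>weight_recursion\<close> rewrites the last term.\<close>

lemma lborel_integral_radial_derivative:
  fixes u :: "real^'n::finite \<Rightarrow> real"
  assumes u: "smooth u" and k: "k \<ge> 2"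
  shows "(LINT x|lborel. (x \<bullet> grad u x) * weight k s x)
    = 2 * s * wint (k - 1) u s - (real CARD('n) + 2 * real k) * wint k u s"
proof -
  have c0: "continuous_on UNIV u" and c1: "continuous_on UNIV (partial i u)" for i
    using u smooth_continuous smooth_partial by blast+
  have int1: "integrable lborel (\<lambda>x. (partial i u x * x $ i) * weight k s x)" for i
    using k by (intro integrable_weight continuous_intros c1) auto
  have int2: "integrable lborel (\<lambda>x. u x * weight k s x)" "integrable lborel (\<lambda>x. u x * weight (k - 1) s x)"
    using k by (intro integrable_weight c0; simp)+
  have int3: "integrable lborel (\<lambda>x. (u x * (x $ i)\<^sup>2) * weight (k - 1) s x)" for i
    using k by (intro integrable_weight continuous_intros c0) auto
  have zero: "(LINT x|lborel. (partial i u x * x $ i) * weight k s x + u x * weight k s x - 2 * ((u x * (x $ i)\<^sup>2) * weight (k - 1) s x)) = 0" for i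
  proof (rule lborel_integral_directional_derivative_eq_0
      [where e = "axis i 1" and G = "\<lambda>x. (u x * x $ i) * weight k s x" and r = "sqrt \<bar>s\<bar>"])
    have d: "((\<lambda>t. (x + t *\<^sub>R axis i 1) $ i) has_real_derivative 1) (at 0)" for x :: "real^'n"
      by (auto intro!: derivative_eq_intros simp: axis_def)
    show "((\<lambda>t. (u (x + t *\<^sub>R axis i 1) * (x + t *\<^sub>R axis i 1) $ i) * weight k s (x + t *\<^sub>R axis i 1)) has_real_derivative
        (partial i u x * x $ i) * weight k s x + u x * weight k s x - 2 * ((u x * (x $ i)\<^sup>2) * weight (k - 1) s x)) (at 0)" for x
      using DERIV_mult[OF DERIV_mult[OF DERIV_line_axis[OF smooth_differentiable[OF u], of x i] d]
          DERIV_weight_line[OF k, of s x "axis i 1"]]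
      by (simp add: inner_axis algebra_simps power2_eq_square)
    show "continuous_on UNIV (\<lambda>x. (u x * x $ i) * weight k s x)"
      by (intro continuous_intros c0)
    show "continuous_on UNIV (\<lambda>x. (partial i u x * x $ i) * weight k s x + u x * weight k s x - 2 * ((u x * (x $ i)\<^sup>2) * weight (k - 1) s x))"
      by (intro continuous_intros c0 c1)
  qed (use k in \<open>simp add: norm_gt_imp_weight_eq_0\<close>)
  have split: "(LINT x|lborel. (partial i u x * x $ i) * weight k s x + u x * weight k s x - 2 * ((u x * (x $ i)\<^sup>2) * weight (k - 1) s x))
      = (LINT x|lborel. (partial i u x * x $ i) * weight k s x) + wint k u s
        - 2 * (LINT x|lborel. (u x * (x $ i)\<^sup>2) * weight (k - 1) s x)" for i
    unfolding wint_def
    by (subst Bochner_Integration.integral_diff)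
       (use int1[of i] int2(1) int3[of i] in \<open>simp_all only: Bochner_Integration.integrable_add
         integrable_mult_right Bochner_Integration.integral_add integral_mult_right_zero\<close>)
  have eq: "(LINT x|lborel. (partial i u x * x $ i) * weight k s x)
      = 2 * (LINT x|lborel. (u x * (x $ i)\<^sup>2) * weight (k - 1) s x) - wint k u s" for i
    using zero[of i] split[of i] by linarith
  have "(LINT x|lborel. (x \<bullet> grad u x) * weight k s x) = (\<Sum>i\<in>UNIV. LINT x|lborel. (partial i u x * x $ i) * weight k s x)"
    unfolding inner_grad_eq_sum by (rule Bochner_Integration.integral_sum) (rule int1)
  also have "\<dots> = 2 * (\<Sum>i\<in>UNIV. LINT x|lborel. (u x * (x $ i)\<^sup>2) * weight (k - 1) s x) - real CARD('n) * wint k u s"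
    by (simp add: eq sum_subtractf sum_distrib_left)
  also have "(\<Sum>i\<in>UNIV. LINT x|lborel. (u x * (x $ i)\<^sup>2) * weight (k - 1) s x)
      = (LINT x|lborel. (\<Sum>i\<in>UNIV. (u x * (x $ i)\<^sup>2) * weight (k - 1) s x))"
    using int3 by simp
  also have "(\<lambda>x. \<Sum>i\<in>UNIV. (u x * (x $ i)\<^sup>2) * weight (k - 1) s x) = (\<lambda>x. u x * ((x \<bullet> x) * weight (k - 1) s x))"
    by (simp add: inner_vec_def sum_distrib_left sum_distrib_right power2_eq_square mult.assoc)
  also have "(LINT x|lborel. u x * ((x \<bullet> x) * weight (k - 1) s x))
      = (LINT x|lborel. s * (u x * weight (k - 1) s x) - real k * (u x * weight k s x))"
    unfolding weight_recursion[OF k] by (simp add: algebra_simps)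
  also have "\<dots> = s * wint (k - 1) u s - real k * wint k u s"
    using int2 by (simp add: Bochner_Integration.integral_diff wint_def)
  finally show ?thesis by (simp add: algebra_simps)
qed

text \<open>The number m is half the dimension. Scaling x by the square root of s shows that the
  weighted integral of a constant is a multiple of s^(m + k), so this is a mean up to a constant
  factor, which \<open>wavg_const\<close> computes for k = 2.\<close>

definition wavg :: "nat \<Rightarrow> nat \<Rightarrow> (real^'n::finite \<Rightarrow> real) \<Rightarrow> real \<Rightarrow> real" where
  "wavg m k h s = wint k h s / s ^ (m + k)"

text \<open>Combining the two integrations by parts expresses the weighted integral of the Laplacian
  through those of u with exponents k - 1 and k. That combination is, up to a factor, the numerator
  in the quotient rule for \<open>wavg\<close>.\<close>

lemma DERIV_wavg:
  fixes u :: "real^'n::finite \<Rightarrow> real"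
  assumes u: "smooth u" and k: "k \<ge> 2" and m: "CARD('n) = 2 * m" and s: "s > 0"
  shows "(wavg m k u has_real_derivative wavg m (k + 1) (laplacian u) s / 4) (at s)"
proof -
  have L: "wint (k + 1) (laplacian u) s = 4 * s * wint (k - 1) u s - 4 * real (m + k) * wint k u s"
    using wint_laplacian[OF u k, of s] lborel_integral_radial_derivative[OF u k, of s]
    by (simp add: m algebra_simps)
  obtain j where j: "m + k = Suc j" using k by (cases "m + k") auto
  have "((\<lambda>s. wint k u s / s ^ (m + k)) has_real_derivative
      (wint (k - 1) u s * s ^ (m + k) - wint k u s * (real (m + k) * s ^ (m + k - 1))) / (s ^ (m + k) * s ^ (m + k))) (at s)"
    using s DERIV_wint[OF smooth_continuous[OF u] k, of s] DERIV_pow[of "m + k" s UNIV]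
    by (intro DERIV_divide) auto
  also have "(wint (k - 1) u s * s ^ (m + k) - wint k u s * (real (m + k) * s ^ (m + k - 1))) / (s ^ (m + k) * s ^ (m + k))
      = wavg m (k + 1) (laplacian u) s / 4"
    using s unfolding wavg_def L add.assoc[symmetric] unfolding j
    by (simp add: divide_simps) (simp add: algebra_simps)
  finally show ?thesis by (simp add: wavg_def[abs_def])
qed

subsection \<open>Asymptotics of antiderivatives\<close>

lemma DERIV_inverse_power_at_top:
  "s > 0 \<Longrightarrow> ((\<lambda>s::real. 1 / s ^ Suc i) has_real_derivative - (real (Suc i) / s ^ Suc (Suc i))) (at s)"
proof -
  assume s: "s > 0"
  have "((\<lambda>s::real. 1 / s ^ Suc i) has_real_derivative
      (0 * s ^ Suc i - 1 * (real (Suc i) * s ^ i)) / (s ^ Suc i * s ^ Suc i)) (at s)"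
    using s DERIV_pow[of "Suc i" s UNIV] by (intro DERIV_divide DERIV_const) auto
  also have "(0 * s ^ Suc i - 1 * (real (Suc i) * s ^ i)) / (s ^ Suc i * s ^ Suc i)
      = - (real (Suc i) / s ^ Suc (Suc i))"
    using s by (simp add: divide_simps)
  finally show ?thesis .
qed

lemma le_tendsto_of_derivative_le:
  fixes f g :: "real \<Rightarrow> real"
  assumes "\<And>s. s \<ge> s0 \<Longrightarrow> (f has_real_derivative f' s) (at s)"
    and "\<And>s. s \<ge> s0 \<Longrightarrow> f' s \<ge> 0" and "(f \<longlongrightarrow> c) at_top" and "s \<ge> s0"
  shows "f s \<le> c"
proof (rule tendsto_lowerbound[OF assms(3)])
  show "\<forall>\<^sub>F t in at_top. f s \<le> f t"
    using eventually_ge_at_top[of s]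
  proof eventually_elim
    case (elim t)
    show ?case
      by (rule DERIV_nonneg_imp_nondecreasing[OF elim]) (use assms in \<open>meson order_trans\<close>)
  qed
qed simp

text \<open>The functions G - B/s and G + B/s are monotone in opposite directions, so G oscillates
  by at most B/s beyond s.\<close>

lemma convergent_of_derivative_decay:
  fixes G H :: "real \<Rightarrow> real"
  assumes der: "\<And>s. s \<ge> s0 \<Longrightarrow> (G has_real_derivative H s) (at s)"
    and bound: "\<And>s. s \<ge> s0 \<Longrightarrow> \<bar>H s\<bar> \<le> B / s\<^sup>2" and s0: "s0 > 0" and B: "B \<ge> 0"
  obtains c where "(G \<longlongrightarrow> c) at_top"
proof -
  have d: "((\<lambda>s. B * (1 / s ^ Suc 0)) has_real_derivative - (B / s\<^sup>2)) (at s)" if "s \<ge> s0" for s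
    using DERIV_cmult[OF DERIV_inverse_power_at_top[of s 0], of B] that s0 by (simp add: power2_eq_square)
  have osc: "\<bar>G t - G s\<bar> \<le> B / s" if "s0 \<le> s" "s \<le> t" for s t
  proof -
    have "(G s - B * (1 / s ^ Suc 0)) \<le> (G t - B * (1 / t ^ Suc 0))"
    proof (rule DERIV_nonneg_imp_nondecreasing[OF that(2)])
      fix x assume x: "s \<le> x" "x \<le> t"
      have "((\<lambda>s. G s - B * (1 / s ^ Suc 0)) has_real_derivative H x - - (B / x\<^sup>2)) (at x)"
        using x that by (intro DERIV_diff der d) auto
      moreover have "H x - - (B / x\<^sup>2) \<ge> 0" using bound[of x] x that by auto
      ultimately show "\<exists>y. ((\<lambda>s. G s - B * (1 / s ^ Suc 0)) has_real_derivative y) (at x) \<and> 0 \<le> y" by blast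
    qed
    moreover have "(G s + B * (1 / s ^ Suc 0)) \<ge> (G t + B * (1 / t ^ Suc 0))"
    proof (rule DERIV_nonpos_imp_nonincreasing[OF that(2)])
      fix x assume x: "s \<le> x" "x \<le> t"
      have "((\<lambda>s. G s + B * (1 / s ^ Suc 0)) has_real_derivative H x + - (B / x\<^sup>2)) (at x)"
        using x that by (intro DERIV_add der d) auto
      moreover have "H x + - (B / x\<^sup>2) \<le> 0" using bound[of x] x that by auto
      ultimately show "\<exists>y. ((\<lambda>s. G s + B * (1 / s ^ Suc 0)) has_real_derivative y) (at x) \<and> y \<le> 0" by blast
    qed
    moreover have "B / t \<ge> 0" using that s0 B by auto
    ultimately show ?thesis by auto
  qed
  \<comment> \<open>Completeness is used along a sequence only; the oscillation bound then carries
    the limit over to all large arguments.\<close>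
  have "Cauchy (\<lambda>n. G (s0 + real n))"
    unfolding Cauchy_altdef2
  proof (intro allI impI)
    fix e :: real assume "e > 0"
    obtain N :: nat where N: "real N > B / e" using reals_Archimedean2 by blast
    have "dist (G (s0 + real n)) (G (s0 + real N)) < e" if "n \<ge> N" for n
    proof -
      have "\<bar>G (s0 + real n) - G (s0 + real N)\<bar> \<le> B / (s0 + real N)"
        using that s0 by (intro osc) auto
      also have "\<dots> < e"
      proof -
        have "B < e * real N" using N \<open>e > 0\<close> by (simp add: pos_divide_less_eq mult.commute)
        moreover have "0 < e * s0" using \<open>e > 0\<close> s0 by simp
        ultimately have "B < e * (s0 + real N)" unfolding distrib_left by linarith
        then show ?thesis using s0 by (simp add: pos_divide_less_eq add_pos_nonneg)
      qed
      finally show ?thesis by (simp add: dist_real_def)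
    qed
    then show "\<exists>N. \<forall>n\<ge>N. dist (G (s0 + real n)) (G (s0 + real N)) < e" by blast
  qed
  then obtain c where c: "(\<lambda>n. G (s0 + real n)) \<longlonglongrightarrow> c"
    using Cauchy_convergent convergent_def by blast
  have "\<bar>G s - c\<bar> \<le> B / s" if s: "s \<ge> s0" for s
  proof (rule tendsto_upperbound)
    show "(\<lambda>n. \<bar>G s - G (s0 + real n)\<bar>) \<longlonglongrightarrow> \<bar>G s - c\<bar>" by (intro tendsto_intros c)
    have "\<forall>\<^sub>F n in sequentially. s - s0 \<le> real n"
      using filterlim_real_sequentially unfolding filterlim_at_top by blast
    then show "\<forall>\<^sub>F n in sequentially. \<bar>G s - G (s0 + real n)\<bar> \<le> B / s"
    proof eventually_elim
      case (elim n)
      with osc[OF s, of "s0 + real n"] show ?case by (simp add: abs_minus_commute)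
    qed
  qed simp
  then have "\<forall>\<^sub>F s in at_top. norm (G s - c) \<le> B / s"
    unfolding eventually_at_top_linorder by auto
  moreover have "((\<lambda>s. B / s) \<longlongrightarrow> 0) at_top" by real_asymp
  ultimately have "((\<lambda>s. G s - c) \<longlongrightarrow> 0) at_top" by (rule Lim_null_comparison)
  then have "(G \<longlongrightarrow> c) at_top" using LIM_zero_iff by blast
  then show ?thesis using that by blast
qed

text \<open>G is compared with the exact antiderivatives of (L - e/2)/s^(i+2) and (L + e/2)/s^(i+2)
  that vanish at infinity: each difference is monotone and tends to 0, which fixes its sign.\<close>

lemma tendsto_antiderivative_decay:
  fixes G H :: "real \<Rightarrow> real"
  assumes der: "\<And>s. s > 0 \<Longrightarrow> (G has_real_derivative H s) (at s)"
    and lim: "((\<lambda>s. s ^ Suc (Suc i) * H s) \<longlongrightarrow> L) at_top" and G: "(G \<longlongrightarrow> 0) at_top"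
  shows "((\<lambda>s. s ^ Suc i * G s) \<longlongrightarrow> - L / real (Suc i)) at_top"
proof (rule tendstoI)
  fix e :: real assume e: "e > 0"
  have "\<forall>\<^sub>F s in at_top. dist (s ^ Suc (Suc i) * H s) L < e / 2" using lim e half_gt_zero tendstoD by blast
  then obtain s1 where s1: "\<And>s. s \<ge> s1 \<Longrightarrow> \<bar>s ^ Suc (Suc i) * H s - L\<bar> < e / 2"
    unfolding eventually_at_top_linorder dist_real_def by blast
  define s0 where "s0 = max s1 1"
  have s0: "s0 \<ge> 1" "s0 \<ge> s1" by (auto simp: s0_def)
  \<comment> \<open>Chosen so that \<open>F b\<close> has derivative H - b/s^(i+2) and still tends
    to 0.\<close>
  define F where "F = (\<lambda>b s. G s + b / real (Suc i) * (1 / s ^ Suc i))"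
  have dF: "(F b has_real_derivative H s - b / s ^ Suc (Suc i)) (at s)" if "s \<ge> s0" for b s
  proof -
    have s: "s > 0" using that s0 by linarith
    have "(F b has_real_derivative H s + b / real (Suc i) * - (real (Suc i) / s ^ Suc (Suc i))) (at s)"
      unfolding F_def using s by (intro DERIV_add der DERIV_cmult DERIV_inverse_power_at_top)
    then show ?thesis by (simp add: divide_simps split: if_splits)
  qed
  have limF: "(F b \<longlongrightarrow> 0) at_top" for b
  proof -
    have "((\<lambda>s::real. b / real (Suc i) * (1 / s ^ Suc i)) \<longlongrightarrow> 0) at_top"
      by real_asymp
    from tendsto_add[OF G this] show ?thesis by (simp add: F_def)
  qed
  have H: "(L - e/2) / s ^ Suc (Suc i) \<le> H s" "H s \<le> (L + e/2) / s ^ Suc (Suc i)" if "s \<ge> s0" for s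
  proof -
    have "s ^ Suc (Suc i) > 0" using that s0 by auto
    then show "(L - e/2) / s ^ Suc (Suc i) \<le> H s" "H s \<le> (L + e/2) / s ^ Suc (Suc i)"
      using s1[OF order_trans[OF s0(2) that]]
      unfolding pos_divide_le_eq[OF \<open>s ^ Suc (Suc i) > 0\<close>] pos_le_divide_eq[OF \<open>s ^ Suc (Suc i) > 0\<close>]
      by (auto simp only: mult.commute[of "H s"] abs_less_iff)
  qed
  have up: "F (L - e/2) s \<le> 0" if "s \<ge> s0" for s
    by (rule le_tendsto_of_derivative_le[OF dF _ limF that]) (use H in auto)
  have lo: "F (L + e/2) s \<ge> 0" if "s \<ge> s0" for s
  proof -
    have "- F (L + e/2) s \<le> 0"
      by (rule le_tendsto_of_derivative_le[where f = "\<lambda>s. - F (L + e/2) s", OF DERIV_minus[OF dF] _ _ that])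
         (use H tendsto_minus[OF limF[of "L + e/2"]] in auto)
    then show ?thesis by simp
  qed
  show "\<forall>\<^sub>F s in at_top. dist (s ^ Suc i * G s) (- L / real (Suc i)) < e"
    using eventually_ge_at_top[of s0]
  proof eventually_elim
    case (elim s)
    define p where "p = s ^ Suc i"
    have p: "p > 0" using elim s0 by (auto simp: p_def)
    define r where "r = real (Suc i)"
    have r: "r \<ge> 1" by (simp add: r_def)
    have "p * F (L - e/2) s \<le> 0" "p * F (L + e/2) s \<ge> 0"
      using up[OF elim] lo[OF elim] p by (auto simp: mult_le_0_iff)
    then have "p * G s + (L - e/2) / r \<le> 0" "p * G s + (L + e/2) / r \<ge> 0"
      using p unfolding F_def p_def[symmetric] r_def[symmetric] distrib_left by simp_all
    moreover have "e / 2 / r \<le> e / 2" using r e by (simp add: divide_le_eq)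
    ultimately have "\<bar>p * G s - (- L / r)\<bar> \<le> e / 2"
      unfolding abs_le_iff diff_divide_distrib add_divide_distrib minus_divide_left[symmetric] by linarith
    then show ?case using e by (simp add: dist_real_def p_def r_def)
  qed
qed

text \<open>L'Hospital's rule with the denominator s^(d+1). As this tends to infinity, the constant
  of integration of G has no influence on the limit.\<close>

lemma tendsto_antiderivative_growth:
  fixes G H :: "real \<Rightarrow> real"
  assumes der: "\<And>s. s > 0 \<Longrightarrow> (G has_real_derivative H s) (at s)"
    and lim: "((\<lambda>s. H s / s ^ d) \<longlongrightarrow> a) at_top"
  shows "((\<lambda>s. G s / s ^ Suc d) \<longlongrightarrow> a / real (Suc d)) at_top"
proof (rule lhospital_at_top_at_top)
  show "LIM x at_top. x ^ Suc d :> (at_top :: real filter)" by real_asymp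
  show "\<forall>\<^sub>F x in at_top. (G has_real_derivative H x) (at x)"
    using eventually_gt_at_top[of 0] by eventually_elim (rule der)
  show "\<forall>\<^sub>F x :: real in at_top. ((\<lambda>x. x ^ Suc d) has_real_derivative real (Suc d) * x ^ d) (at x)"
    using DERIV_pow[of "Suc d"] by (simp del: of_nat_Suc power_Suc)
  show "\<forall>\<^sub>F x :: real in at_top. real (Suc d) * x ^ d \<noteq> 0"
    using eventually_gt_at_top[of 0] by eventually_elim auto
  have "((\<lambda>x. H x / x ^ d / real (Suc d)) \<longlongrightarrow> a / real (Suc d)) at_top"
    by (intro tendsto_intros lim) simp
  then show "((\<lambda>x. H x / (real (Suc d) * x ^ d)) \<longlongrightarrow> a / real (Suc d)) at_top"
    by (simp add: mult.commute)
qed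

text \<open>Undoing one derivative adds a constant of integration. Once that constant is nonzero the
  function behaves like a polynomial from then on.\<close>

lemma derivative_chain_asymptotics:
  fixes G :: "nat \<Rightarrow> real \<Rightarrow> real"
  assumes der: "\<And>j s. s > 0 \<Longrightarrow> (G j has_real_derivative G (Suc j) s) (at s)"
    and lim: "((\<lambda>s. s ^ Suc p * G (j + p) s) \<longlongrightarrow> L) at_top"
  shows "((\<lambda>s. s * G j s) \<longlongrightarrow> (- 1) ^ p * L / fact p) at_top \<or>
    (\<exists>d a. a \<noteq> 0 \<and> ((\<lambda>s. G j s / s ^ d) \<longlongrightarrow> a) at_top)"
  using lim
proof (induction p arbitrary: L)
  case 0
  then show ?case by simp
next
  case (Suc p)
  have "((\<lambda>s. \<bar>s ^ Suc (Suc p) * G (j + Suc p) s\<bar>) \<longlongrightarrow> \<bar>L\<bar>) at_top"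
    by (intro tendsto_intros Suc.prems)
  then have "\<forall>\<^sub>F s in at_top. \<bar>s ^ Suc (Suc p) * G (j + Suc p) s\<bar> < \<bar>L\<bar> + 1"
    by (rule order_tendstoD) simp
  then obtain s1 where s1: "\<And>s. s \<ge> s1 \<Longrightarrow> \<bar>s ^ Suc (Suc p) * G (j + Suc p) s\<bar> < \<bar>L\<bar> + 1"
    unfolding eventually_at_top_linorder by blast
  define s0 where "s0 = max s1 1"
  \<comment> \<open>For s at least 1 the decay of order s^-(p+2) is at least s^-2, enough for the
    antiderivative to converge.\<close>
  have bound: "\<bar>G (j + Suc p) s\<bar> \<le> (\<bar>L\<bar> + 1) / s\<^sup>2" if "s \<ge> s0" for s
  proof -
    have s: "s \<ge> 1" "s \<ge> s1" using that by (auto simp: s0_def)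
    have "s\<^sup>2 * \<bar>G (j + Suc p) s\<bar> \<le> s ^ Suc (Suc p) * \<bar>G (j + Suc p) s\<bar>"
      using s by (intro mult_right_mono power_increasing) auto
    also have "\<dots> \<le> \<bar>L\<bar> + 1" using s1[of s] s by (simp add: abs_mult)
    finally show ?thesis using s by (simp add: pos_le_divide_eq mult.commute)
  qed
  obtain c where c: "(G (j + p) \<longlongrightarrow> c) at_top"
    by (rule convergent_of_derivative_decay[of s0 "G (j + p)" "G (j + Suc p)" "\<bar>L\<bar> + 1"])
       (use der bound in \<open>auto simp: s0_def\<close>)
  show ?case
  proof (cases "c = 0")
    case True
    have "((\<lambda>s. s ^ Suc p * G (j + p) s) \<longlongrightarrow> - L / real (Suc p)) at_top"
      by (rule tendsto_antiderivative_decay[of _ "G (j + Suc p)"]) (use der Suc.prems c True in auto)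
    from Suc.IH[OF this] show ?thesis by (simp add: mult_ac)
  next
    case False
    \<comment> \<open>Starting from the nonzero limit c, each of the remaining p antiderivatives
      raises the power of s by one.\<close>
    have "\<exists>d a. a \<noteq> 0 \<and> ((\<lambda>s. G (j + p - q) s / s ^ d) \<longlongrightarrow> a) at_top" if "q \<le> p" for q
      using that
    proof (induction q)
      case 0
      have "((\<lambda>s. G (j + p - 0) s / s ^ 0) \<longlongrightarrow> c) at_top" using c by simp
      then show ?case using False by blast
    next
      case (Suc q)
      then obtain d a where da: "a \<noteq> 0" "((\<lambda>s. G (j + p - q) s / s ^ d) \<longlongrightarrow> a) at_top" by auto
      have "Suc (j + p - Suc q) = j + p - q" using Suc.prems by auto
      then have "((\<lambda>s. G (j + p - Suc q) s / s ^ Suc d) \<longlongrightarrow> a / real (Suc d)) at_top"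
        using der[of _ "j + p - Suc q"] da by (intro tendsto_antiderivative_growth) auto
      moreover have "a / real (Suc d) \<noteq> 0" using da by simp
      ultimately show ?case by blast
    qed
    from this[of p] show ?thesis by simp
  qed
qed

subsection \<open>Normalisation and limits of the averages\<close>

lemma wint_cmult: "wint k (\<lambda>x. c * h x) s = c * wint k h s"
  by (simp add: wint_def mult.assoc)

lemma wint_uminus: "wint k (\<lambda>x. - h x) s = - wint k h s"
  by (simp add: wint_def)

lemma wint_add:
  assumes "continuous_on UNIV g" "continuous_on UNIV h" "k > 0"
  shows "wint k (\<lambda>x. g x + h x) s = wint k g s + wint k h s"
  unfolding wint_def distrib_right
  by (rule Bochner_Integration.integral_add) (intro integrable_weight assms)+

lemma wint_mono:
  assumes "continuous_on UNIV g" "continuous_on UNIV h" "k > 0"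
    and "\<And>x. x \<bullet> x < s \<Longrightarrow> g x \<le> h x"
  shows "wint k g s \<le> wint k h s"
  unfolding wint_def
proof (intro integral_mono integrable_weight assms)
  fix x show "g x * weight k s x \<le> h x * weight k s x"
    using assms(3,4) by (cases "x \<bullet> x < s") (auto simp: weight_eq_0 intro: mult_right_mono)
qed

lemma partial_const: "partial i (\<lambda>x::real^'n::finite. c) = (\<lambda>x. 0)"
  using partial_eqI[OF has_derivative_const] by (intro ext) auto

lemma smooth_const: "smooth (\<lambda>x::real^'n::finite. c)"
  by (simp add: smooth_def Ck_const)

lemma laplacian_const: "laplacian (\<lambda>x::real^'n::finite. c) = (\<lambda>x. 0)"
  by (simp add: laplacian_def[abs_def] partial_const)

text \<open>The increment of the weight is exactly h on the unit ball, and between 0 and h on the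
  slightly larger ball that supports it. This serves to differentiate at s = 1 for exponent 1, a
  case outside the range of \<open>DERIV_wint\<close>.\<close>

lemma wint_1_difference:
  assumes h: "h \<ge> 0"
  shows "h * measure lborel (cball (0::'a::euclidean_space) 1) \<le> wint 1 (\<lambda>x::'a. 1) (1 + h) - wint 1 (\<lambda>x::'a. 1) 1"
    and "wint 1 (\<lambda>x::'a. 1) (1 + h) - wint 1 (\<lambda>x::'a. 1) 1 \<le> h * measure lborel (cball (0::'a) (sqrt (1 + h)))"
proof -
  have int: "integrable lborel (\<lambda>x::'a. 1 * weight 1 s x)" for s
    by (intro integrable_weight continuous_intros) auto
  have ball: "integrable lborel (\<lambda>x::'a. h * indicator (cball 0 r) x)"
    and content: "(LINT x::'a|lborel. h * indicator (cball 0 r) x) = h * measure lborel (cball (0::'a) r)" for r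
    using emeasure_lborel_cball_finite[of "0::'a" r] by (auto simp: top.not_eq_extremum intro!: integrable_real_indicator)
  have diff: "wint 1 (\<lambda>x::'a. 1) (1 + h) - wint 1 (\<lambda>x::'a. 1) 1 = (LINT x::'a|lborel. 1 * weight 1 (1 + h) x - 1 * weight 1 1 x)"
    unfolding wint_def by (rule Bochner_Integration.integral_diff[symmetric]) (rule int)+
  have sq: "x \<bullet> x \<le> r\<^sup>2 \<longleftrightarrow> x \<in> cball 0 r" if "r \<ge> 0" for x :: 'a and r
    using that by (simp flip: power2_norm_eq_inner)
  show "h * measure lborel (cball (0::'a) 1) \<le> wint 1 (\<lambda>x::'a. 1) (1 + h) - wint 1 (\<lambda>x::'a. 1) 1"
    unfolding diff content[symmetric]
  proof (intro integral_mono ball Bochner_Integration.integrable_diff int)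
    fix x :: 'a
    show "h * indicator (cball 0 1) x \<le> 1 * weight 1 (1 + h) x - 1 * weight 1 1 x"
      using sq[of 1 x] h by (cases "x \<in> cball 0 1") (auto simp: weight_def max_def)
  qed
  show "wint 1 (\<lambda>x::'a. 1) (1 + h) - wint 1 (\<lambda>x::'a. 1) 1 \<le> h * measure lborel (cball (0::'a) (sqrt (1 + h)))"
    unfolding diff content[symmetric]
  proof (intro integral_mono ball Bochner_Integration.integrable_diff int)
    fix x :: 'a
    show "1 * weight 1 (1 + h) x - 1 * weight 1 1 x \<le> h * indicator (cball 0 (sqrt (1 + h))) x"
      using sq[of "sqrt (1 + h)" x] h by (cases "x \<in> cball 0 (sqrt (1 + h))") (auto simp: weight_def max_def)
  qed
qed

text \<open>By \<open>DERIV_wavg\<close> the value is independent of s. To find it, the exponent is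
  lowered from 2 to 1 by the radial identity and then from 1 to 0 by a one-sided derivative, which
  leaves the volume of the unit ball.\<close>

lemma wavg_const:
  assumes dim: "CARD('n::finite) = 2 * m" and s: "s > 0"
  shows "wavg m 2 (\<lambda>x::real^'n. 1) s = pi ^ m / fact (m + 2)"
proof -
  let ?one = "\<lambda>x::real^'n. 1 :: real"
  define c where "c = wavg m 2 ?one 1"
  have const: "wavg m 2 ?one s = c" if s: "s > 0" for s
    unfolding c_def
  proof (rule DERIV_isconst3[where f = "wavg m 2 ?one" and a = 0 and b = "s + 2"])
    fix t assume "t \<in> {0<..<s + 2}"
    then show "(wavg m 2 ?one has_real_derivative 0) (at t)"
      using DERIV_wavg[OF smooth_const _ dim, of 2 t 1] by (simp add: laplacian_const wavg_def wint_def)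
  qed (use s in auto)
  have I2: "wint 2 ?one s = c * s ^ (m + 2)" if "s > 0" for s
    using const[OF that] that by (simp add: wavg_def field_simps)
  have grad: "grad ?one x = 0" for x
    by (simp add: grad_def partial_const vec_eq_iff)
  \<comment> \<open>The radial identity with k = 2 and vanishing gradient gives s
    \<open>wint 1\<close> = (m + 2) \<open>wint 2\<close>.\<close>
  have I1: "wint 1 ?one s = (real m + 2) * c * s ^ (m + 1)" if "s > 0" for s
  proof -
    have "s * wint 1 ?one s = s * ((real m + 2) * c * s ^ (m + 1))"
      using lborel_integral_radial_derivative[OF smooth_const, of 2 1 s, where 'n = 'n] I2[OF that]
      by (simp add: dim grad algebra_simps)
    then show ?thesis using that by simp
  qed
  define V where "V = pi ^ m / fact m"
  have content: "measure lborel (cball (0::real^'n) r) = V * r ^ (2 * m)" if "r \<ge> 0" for r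
    using that content_cball[of r "0::real^'n"] unit_ball_vol_even[of m] by (simp add: dim V_def)
  define F where "F = (\<lambda>t. (real m + 2) * c * t ^ (m + 1))"
  have "(F has_real_derivative (real m + 2) * c * (real (m + 1) * 1 ^ m)) (at 1)"
    unfolding F_def using DERIV_cmult[OF DERIV_pow[of "m + 1" 1 UNIV], of "(real m + 2) * c"] by simp
  then have "((\<lambda>h. (F (1 + h) - F 1) / h) \<longlongrightarrow> (real m + 2) * c * real (m + 1)) (at 0)"
    by (simp add: DERIV_def)
  then have lim: "((\<lambda>h. (F (1 + h) - F 1) / h) \<longlongrightarrow> (real m + 2) * c * real (m + 1)) (at_right 0)"
    by (rule filterlim_mono[OF _ order_refl at_le]) simp
  \<comment> \<open>The same difference quotient is squeezed between the volumes of the balls of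
    radius 1 and \<open>sqrt (1 + h)\<close>.\<close>
  have "((\<lambda>h. (F (1 + h) - F 1) / h) \<longlongrightarrow> V) (at_right 0)"
  proof (rule tendsto_sandwich)
    have F: "F (1 + h) - F 1 = wint 1 ?one (1 + h) - wint 1 ?one 1" if "h > 0" for h
      using that I1[of "1 + h"] I1[of 1] by (simp add: F_def)
    have pos: "\<forall>\<^sub>F h :: real in at_right 0. h > 0" by (simp add: eventually_at_filter)
    show "\<forall>\<^sub>F h in at_right 0. V \<le> (F (1 + h) - F 1) / h"
      using pos by eventually_elim (use wint_1_difference(1)[where 'a = "real^'n"] content[of 1] in
        \<open>simp add: F pos_le_divide_eq mult.commute\<close>)
    show "\<forall>\<^sub>F h in at_right 0. (F (1 + h) - F 1) / h \<le> V * (1 + h) ^ m"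
      using pos
    proof eventually_elim
      case (elim h)
      have "sqrt (1 + h) ^ (2 * m) = (1 + h) ^ m" using elim by (simp add: power_mult)
      then show ?case using wint_1_difference(2)[where 'a = "real^'n", of h] content[of "sqrt (1 + h)"] elim
        by (simp add: F pos_divide_le_eq mult.commute)
    qed
    have "((\<lambda>h. V * (1 + h) ^ m) \<longlongrightarrow> V * (1 + 0) ^ m) (at_right 0)"
      by (intro tendsto_intros)
    then show "((\<lambda>h. V * (1 + h) ^ m) \<longlongrightarrow> V) (at_right 0)" by simp
  qed simp
  with lim have "V = (real m + 2) * c * real (m + 1)"
    using tendsto_unique trivial_limit_at_right_real by blast
  moreover have "pi ^ m = V * fact m" by (simp add: V_def)
  ultimately have "pi ^ m = c * fact (m + 2)" by (simp add: algebra_simps)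
  then have "c = pi ^ m / fact (m + 2)" by (simp add: eq_divide_eq)
  then show ?thesis using const[OF s] by simp
qed

text \<open>Dominated convergence: the rescaled weight tends pointwise to 1/k! and never exceeds
  it.\<close>

lemma wint_over_power_tendsto:
  fixes f :: "'a::euclidean_space \<Rightarrow> real"
  assumes f: "integrable lborel f"
  shows "((\<lambda>s. wint k f s / s ^ k) \<longlongrightarrow> (LINT x|lborel. f x) / fact k) at_top"
proof -
  have [measurable]: "f \<in> borel_measurable borel" using f by auto
  have "((\<lambda>s. LINT x|lborel. f x * (weight k s x / s ^ k)) \<longlongrightarrow> (LINT x|lborel. f x / fact k)) at_top"
  proof (rule integral_dominated_convergence_at_top[where w = "\<lambda>x. \<bar>f x\<bar> / fact k"])
    show "(\<lambda>x. f x * (weight k s x / s ^ k)) \<in> borel_measurable lborel" for s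
      unfolding weight_def by measurable
    show "AE x in lborel. ((\<lambda>s. f x * (weight k s x / s ^ k)) \<longlongrightarrow> f x / fact k) at_top"
    proof (rule AE_I2)
      fix x :: 'a
      have "((\<lambda>s. ((s - x \<bullet> x) / s) ^ k / fact k) \<longlongrightarrow> 1 ^ k / fact k) at_top"
      proof (intro tendsto_intros)
        show "((\<lambda>s. (s - x \<bullet> x) / s) \<longlongrightarrow> 1) at_top" by real_asymp
      qed simp
      then have "((\<lambda>s. weight k s x / s ^ k) \<longlongrightarrow> 1 / fact k) at_top"
        unfolding power_one
      proof (rule Lim_transform_eventually)
        show "\<forall>\<^sub>F s in at_top. ((s - x \<bullet> x) / s) ^ k / fact k = weight k s x / s ^ k"
          using eventually_ge_at_top[of "x \<bullet> x"]
          by eventually_elim (simp add: weight_def power_divide)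
      qed
      from tendsto_mult_left[OF this, of "f x"]
      show "((\<lambda>s. f x * (weight k s x / s ^ k)) \<longlongrightarrow> f x / fact k) at_top" by simp
    qed
    show "\<forall>\<^sub>F s in at_top. AE x in lborel. norm (f x * (weight k s x / s ^ k)) \<le> \<bar>f x\<bar> / fact k"
      using eventually_gt_at_top[of 0]
    proof eventually_elim
      case (elim s)
      have "weight k s x / s ^ k \<le> 1 / fact k" for x :: 'a
        using weight_le[of s k x] elim by (simp add: field_simps)
      then have "\<bar>f x\<bar> * (weight k s x / s ^ k) \<le> \<bar>f x\<bar> * (1 / fact k)" for x
        by (intro mult_left_mono) auto
      then show ?case using elim by (simp add: abs_mult)
    qed
  qed (use f in auto)
  then show ?thesis by (simp add: wint_def)
qed

text \<open>Where |x|^2 < s the left side is at most s^2/2 and \<open>weight 3 (2 * s)\<close> is at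
  least s^3/6. Doubling s thus permits integrals with exponent 2 to be bounded by the energy, which
  has exponent 3.\<close>

lemma weight_2_le_weight_3: "s > 0 \<Longrightarrow> weight 2 s x \<le> 3 / s * weight 3 (2 * s) x"
proof (cases "x \<bullet> x < s")
  case True
  assume s: "s > 0"
  have "max 0 (s - x \<bullet> x) ^ 2 \<le> s ^ 2" using True by (intro power_mono) auto
  moreover have "s ^ 3 \<le> max 0 (2 * s - x \<bullet> x) ^ 3" using True s by (intro power_mono) auto
  ultimately show ?thesis using s
    by (simp add: weight_def fact_numeral pos_le_divide_eq) (simp add: power2_eq_square power3_eq_cube mult_mono)
qed (simp add: weight_eq_0)

lemma wavg_tendsto_center:
  fixes h :: "real^'n::finite \<Rightarrow> real"
  assumes h: "continuous_on UNIV h" and dim: "CARD('n) = 2 * m"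
  shows "(wavg m 2 h \<longlongrightarrow> pi ^ m / fact (m + 2) * h 0) (at_right 0)"
proof (rule tendstoI)
  fix e :: real assume e: "e > 0"
  define c where "c = pi ^ m / (fact (m + 2) :: real)"
  have c: "c > 0" by (simp add: c_def)
  have "isCont h 0" using h continuous_on_eq_continuous_at by blast
  \<comment> \<open>The constant function 1 has average c, so this tolerance for h becomes e/2 for
    the average.\<close>
  then obtain d where d: "d > 0" "\<And>x. dist x 0 < d \<Longrightarrow> dist (h x) (h 0) < e / (2 * c)"
    using e c unfolding continuous_at_eps_delta by (metis divide_pos_pos mult_pos_pos zero_less_numeral)
  have "\<forall>\<^sub>F s in at_right 0. 0 < s \<and> s < d\<^sup>2"
    using eventually_at_right_real[of 0 "d\<^sup>2"] d by simp
  then show "\<forall>\<^sub>F s in at_right 0. dist (wavg m 2 h s) (pi ^ m / fact (m + 2) * h 0) < e"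
  proof eventually_elim
    case (elim s)
    have near: "\<bar>h x - h 0\<bar> \<le> e / (2 * c)" if "x \<bullet> x < s" for x
    proof -
      have "(norm x)\<^sup>2 < d\<^sup>2" using that elim by (simp add: power2_norm_eq_inner)
      then have "norm x < d" using d by (meson power_less_imp_less_base less_imp_le)
      then show ?thesis using d(2)[of x] by (simp add: dist_real_def)
    qed
    have one: "wavg m 2 (\<lambda>x::real^'n. b) s = b * c" for b
    proof -
      have "wavg m 2 (\<lambda>x::real^'n. b) s = b * wavg m 2 (\<lambda>x::real^'n. 1) s"
        using wint_cmult[of 2 b "\<lambda>x::real^'n. 1" s] by (simp add: wavg_def)
      then show ?thesis using wavg_const[OF dim, of s] elim by (simp only: c_def)
    qed
    have "wavg m 2 h s \<le> wavg m 2 (\<lambda>x::real^'n. h 0 + e / (2 * c)) s"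
      unfolding wavg_def
    proof (rule divide_right_mono)
      show "wint 2 h s \<le> wint 2 (\<lambda>x::real^'n. h 0 + e / (2 * c)) s"
        by (rule wint_mono[OF h continuous_on_const]) (use near in \<open>auto simp: abs_le_iff algebra_simps\<close>)
    qed (use elim in simp)
    moreover have "wavg m 2 h s \<ge> wavg m 2 (\<lambda>x::real^'n. h 0 - e / (2 * c)) s"
      unfolding wavg_def
    proof (rule divide_right_mono)
      show "wint 2 (\<lambda>x::real^'n. h 0 - e / (2 * c)) s \<le> wint 2 h s"
        by (rule wint_mono[OF continuous_on_const h]) (use near in \<open>auto simp: abs_le_iff algebra_simps\<close>)
    qed (use elim in simp)
    ultimately have "\<bar>wavg m 2 h s - c * h 0\<bar> \<le> e / (2 * c) * c"
      unfolding one by (simp add: abs_le_iff algebra_simps)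
    also have "\<dots> < e" using c e by simp
    finally show ?case by (simp add: dist_real_def c_def)
  qed
qed

subsection \<open>Metrics with nonnegative scalar curvature near infinity\<close>

text \<open>With a negative second derivative, f' would be negative just to the right of the
  critical point 0, and the mean value theorem would give values below f(0).\<close>

lemma second_derivative_nonneg_at_min:
  fixes f :: "real \<Rightarrow> real"
  assumes d: "d > 0" and der: "\<And>t. \<bar>t\<bar> < d \<Longrightarrow> (f has_real_derivative f' t) (at t)"
    and der2: "(f' has_real_derivative l) (at 0)"
    and min: "\<And>t. \<bar>t\<bar> < d \<Longrightarrow> f 0 \<le> f t"
  shows "l \<ge> 0"
proof (rule ccontr)
  assume "\<not> l \<ge> 0"
  have "f' 0 = 0"
    using DERIV_local_min[of f "f' 0" 0 d] der[of 0] d min by auto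
  with DERIV_neg_dec_right[OF der2] \<open>\<not> l \<ge> 0\<close>
  obtain e where e: "e > 0" "\<And>h. 0 < h \<Longrightarrow> h < e \<Longrightarrow> f' h < 0" by auto
  define h where "h = min d e / 2"
  have h: "0 < h" "h < d" "h < e" using d e by (auto simp: h_def)
  obtain z where z: "0 < z" "z < h" "f h - f 0 = (h - 0) * f' z"
    using MVT2[of 0 h f f'] der h by auto
  have "f' z < 0" using e z h by auto
  then have "f h - f 0 < 0" using z(3) h by (simp add: mult_pos_neg)
  then show False using min[of h] h by auto
qed

text \<open>With n = 2m the condition \<open>scal\<close> is the sign of the bracket in the scalar
  curvature, since (n - 2)/2 = m - 1, and \<open>integrable\<close> concerns Q e^(nu) by the
  equation defining Q. Having R at least 1 makes ln |x| nonnegative wherever \<open>scal\<close>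
  applies.\<close>

locale nonneg_scalar_curvature =
  fixes u :: "real^'n::finite \<Rightarrow> real" and m :: nat and R :: real
  assumes dim: "CARD('n) = 2 * m" and m: "m \<ge> 2" and smooth: "smooth u"
    and integrable: "integrable lborel ((neg_laplacian ^^ m) u)"
    and R: "R \<ge> 1"
    and scal: "\<And>x. norm x \<ge> R \<Longrightarrow> laplacian u x + (real m - 1) * (norm (grad u x))\<^sup>2 \<le> 0"
begin

definition total :: real where
  "total = (LINT x|lborel. (neg_laplacian ^^ m) u x)"

definition avg_deriv :: "real \<Rightarrow> real" where
  "avg_deriv s = wavg m 3 (laplacian u) s / 4"

text \<open>The exponent 3 is that of \<open>avg_deriv\<close>, so that the curvature inequality can
  be integrated against a single weight.\<close>

definition energy :: "real \<Rightarrow> real" where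
  "energy s = wint 3 (\<lambda>x. (norm (grad u x))\<^sup>2) s"

lemma cont_u: "continuous_on UNIV u"
  using smooth smooth_continuous by blast

lemma cont_grad [continuous_intros]: "continuous_on UNIV (grad u)"
  by (rule smooth_grad_continuous[OF smooth])

lemma cont_laplacian: "continuous_on UNIV (laplacian u)"
  by (intro smooth_continuous smooth_laplacian smooth)

section \<open>Growth of the averages and the Dirichlet energy\<close>

lemma DERIV_average: "s > 0 \<Longrightarrow> (wavg m 2 u has_real_derivative avg_deriv s) (at s)"
  using DERIV_wavg[OF smooth _ dim, of 2 s] by (simp add: avg_deriv_def)

lemma avg_deriv_dichotomy:
  "((\<lambda>s. s * avg_deriv s) \<longlongrightarrow> - total / (4 ^ m * fact (m + 2) * fact (m - 1))) at_top \<or>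
    (\<exists>d a. a \<noteq> 0 \<and> ((\<lambda>s. avg_deriv s / s ^ d) \<longlongrightarrow> a) at_top)"
proof -
  \<comment> \<open>\<open>G j\<close> is the j-th derivative of the average of u: each
    differentiation contributes a quarter of the Laplacian, that is -1/4 times
    \<open>neg_laplacian\<close>.\<close>
  define G where "G = (\<lambda>j s. (- 1 / 4) ^ j * wavg m (j + 2) ((neg_laplacian ^^ j) u) s)"
  have der: "(G j has_real_derivative G (Suc j) s) (at s)" if "s > 0" for j s
  proof -
    have "(wavg m (j + 2) ((neg_laplacian ^^ j) u) has_real_derivative
        wavg m (j + 2 + 1) (laplacian ((neg_laplacian ^^ j) u)) s / 4) (at s)"
      by (rule DERIV_wavg[OF smooth_neg_laplacian_iter[OF smooth] _ dim that]) simp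
    moreover have "wavg m (j + 2 + 1) (laplacian ((neg_laplacian ^^ j) u)) s
        = - wavg m (Suc j + 2) ((neg_laplacian ^^ Suc j) u) s"
      by (simp add: wavg_def neg_laplacian_def[abs_def] wint_uminus)
    ultimately have "(wavg m (j + 2) ((neg_laplacian ^^ j) u) has_real_derivative
        - wavg m (Suc j + 2) ((neg_laplacian ^^ Suc j) u) s / 4) (at s)"
      by simp
    from DERIV_cmult[OF this, of "(- 1 / 4) ^ j"] show ?thesis
      unfolding G_def by (simp add: mult_ac)
  qed
  have G1: "G 1 = avg_deriv"
    by (rule ext) (simp add: G_def avg_deriv_def wavg_def neg_laplacian_def[abs_def] wint_uminus numeral_3_eq_3)
  define L where "L = (- 1 / 4) ^ m * (total / fact (m + 2))"
  \<comment> \<open>The asymptotics are known for \<open>G m\<close> and wanted for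
    \<open>G 1\<close>, which leaves p = m - 1 integrations.\<close>
  obtain p where p: "m = Suc p" using m by (cases m) auto
  have "((\<lambda>s. (- 1 / 4) ^ m * (wint (m + 2) ((neg_laplacian ^^ m) u) s / s ^ (m + 2))) \<longlongrightarrow> L) at_top"
    unfolding L_def total_def by (intro tendsto_intros wint_over_power_tendsto integrable)
  then have "((\<lambda>s. s ^ Suc p * G (1 + p) s) \<longlongrightarrow> L) at_top"
  proof (rule Lim_transform_eventually)
    show "\<forall>\<^sub>F s in at_top. (- 1 / 4) ^ m * (wint (m + 2) ((neg_laplacian ^^ m) u) s / s ^ (m + 2))
        = s ^ Suc p * G (1 + p) s"
      using eventually_gt_at_top[of 0]
    proof eventually_elim
      case (elim s)
      have "s ^ (m + (m + 2)) = s ^ m * s ^ (m + 2)" by (rule power_add)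
      then show ?case using elim by (simp add: G_def wavg_def flip: p)
    qed
  qed
  from derivative_chain_asymptotics[of G, OF der this]
  have "((\<lambda>s. s * avg_deriv s) \<longlongrightarrow> (- 1) ^ p * L / fact p) at_top \<or>
    (\<exists>d a. a \<noteq> 0 \<and> ((\<lambda>s. avg_deriv s / s ^ d) \<longlongrightarrow> a) at_top)"
    unfolding G1 .
  moreover have "(- 1) ^ p * L / fact p = - total / (4 ^ m * fact (m + 2) * fact (m - 1))"
  proof -
    have "(- 1) ^ p * (- 1 / 4) ^ p = ((- 1) * (- 1 / 4 :: real)) ^ p"
      by (rule power_mult_distrib[symmetric])
    then have "(- 1) ^ p * (- 1 / 4 :: real) ^ m = - (1 / 4 ^ m)"
      by (simp add: p power_one_over)
    then have "(- 1) ^ p * L = - (1 / 4 ^ m) * (total / fact (m + 2))"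
      by (simp add: L_def mult.assoc[symmetric] del: fact_Suc)
    then show ?thesis by (simp only: p diff_Suc_1) (simp add: mult_ac del: fact_Suc)
  qed
  ultimately show ?thesis by simp
qed

lemma energy_nonneg: "energy s \<ge> 0"
  unfolding energy_def wint_def by (intro Bochner_Integration.integral_nonneg) auto

text \<open>The curvature inequality is integrated against \<open>weight 3 s\<close>. It can fail
  only in the ball of radius R, whose contribution is at most a multiple of s^3, the maximum of the
  weight up to a factor.\<close>

lemma energy_bound:
  obtains C where "C \<ge> 0" "\<And>s. s > 0 \<Longrightarrow> energy s \<le> C * s ^ 3 - 4 * s ^ (m + 3) * avg_deriv s"
proof -
  define h where "h = (\<lambda>x. laplacian u x + (real m - 1) * (norm (grad u x))\<^sup>2)"
  have cont_h: "continuous_on UNIV h"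
    unfolding h_def by (intro continuous_intros cont_laplacian)
  have "bounded (h ` cball 0 R)"
    by (intro compact_imp_bounded compact_continuous_image continuous_on_subset[OF cont_h] compact_cball) simp
  then obtain B where "\<forall>y\<in>h ` cball 0 R. norm y \<le> B"
    unfolding bounded_iff by blast
  then have B: "\<And>x. norm x \<le> R \<Longrightarrow> \<bar>h x\<bar> \<le> B" by auto
  have B0: "B \<ge> 0" using B[of 0] R by auto
  \<comment> \<open>A continuous, compactly supported majorant of h: the weight is at least 1 on the
    ball of radius R.\<close>
  define b where "b = (\<lambda>x::real^'n. B * weight 1 (R\<^sup>2 + 1) x)"
  have cont_b: "continuous_on UNIV b" unfolding b_def by (intro continuous_intros)
  have hb: "h x \<le> b x" for x
  proof (cases "norm x \<le> R")
    case True
    then have "x \<bullet> x \<le> R\<^sup>2" using power_mono[of "norm x" R 2] by (simp add: power2_norm_eq_inner)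
    then have "weight 1 (R\<^sup>2 + 1) x \<ge> 1" by (simp add: weight_def)
    then have "b x \<ge> B" using B0 mult_left_mono[of 1 "weight 1 (R\<^sup>2 + 1) x" B] by (simp add: b_def)
    then show ?thesis using B[OF True] by auto
  next
    case False
    then have "h x \<le> 0" using scal[of x] by (simp add: h_def)
    also have "0 \<le> b x" using B0 by (simp add: b_def)
    finally show ?thesis .
  qed
  define C where "C = (LINT x|lborel. b x)"
  have int_b: "integrable lborel b"
    unfolding b_def by (intro integrable_weight continuous_intros) auto
  have b0: "b x \<ge> 0" for x using B0 by (simp add: b_def)
  show thesis
  proof
    show "C \<ge> 0" unfolding C_def by (rule Bochner_Integration.integral_nonneg) (rule b0)
    fix s :: real assume s: "s > 0"
    have "wint 3 h s \<le> wint 3 b s"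
      by (rule wint_mono[OF cont_h cont_b _ hb]) simp
    also have "\<dots> \<le> (LINT x|lborel. b x * (s ^ 3 / fact 3))"
      unfolding wint_def
      by (intro integral_mono integrable_weight cont_b mult_left_mono weight_le b0 integrable_mult_left)
        (use s int_b in auto)
    also have "\<dots> = C * (s ^ 3 / fact 3)" by (simp add: C_def)
    also have "\<dots> \<le> C * s ^ 3"
      using s \<open>C \<ge> 0\<close> by (intro mult_left_mono) (auto simp: fact_numeral)
    finally have "wint 3 h s \<le> C * s ^ 3" .
    moreover have "wint 3 h s = wint 3 (laplacian u) s + (real m - 1) * energy s"
      unfolding h_def energy_def
      by (subst wint_add) (auto intro!: continuous_intros cont_laplacian simp: wint_cmult)
    moreover have "wint 3 (laplacian u) s = 4 * s ^ (m + 3) * avg_deriv s"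
      using s by (simp add: avg_deriv_def wavg_def)
    \<comment> \<open>The coefficient m - 1 of the gradient term is at least 1 because n is at least
      4.\<close>
    moreover have "energy s \<le> (real m - 1) * energy s"
      using energy_nonneg[of s] m mult_right_mono[of 1 "real m - 1" "energy s"] by auto
    ultimately show "energy s \<le> C * s ^ 3 - 4 * s ^ (m + 3) * avg_deriv s" by linarith
  qed
qed

lemma average_bounded_derivative_le:
  obtains C where "\<And>s. s > 0 \<Longrightarrow> s ^ m * avg_deriv s \<le> C"
proof -
  obtain C where C: "C \<ge> 0" "\<And>s. s > 0 \<Longrightarrow> energy s \<le> C * s ^ 3 - 4 * s ^ (m + 3) * avg_deriv s"
    using energy_bound by blast
  have "s ^ m * avg_deriv s \<le> C" if s: "s > 0" for s
  proof -
    have "s ^ 3 * (4 * (s ^ m * avg_deriv s)) \<le> s ^ 3 * C"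
      using C(2)[OF s] energy_nonneg[of s] by (simp add: power_add mult_ac)
    then have "4 * (s ^ m * avg_deriv s) \<le> C" using s by (simp only: mult_le_cancel_left_pos zero_less_power)
    then show ?thesis using C(1) by linarith
  qed
  then show thesis by (rule that)
qed

text \<open>The left side is the weighted integral of the radial derivative of u. Cauchy-Schwarz
  with |x| at most the square root of s, followed by Young's inequality with free parameter l,
  bounds it by the energy; l is fixed later as a power of s.\<close>

lemma avg_deriv_le_energy:
  assumes s: "s > 0" and l: "l > 0"
  shows "2 * s ^ (m + 3) * \<bar>avg_deriv s\<bar> \<le> sqrt s / 2 * (l * (pi ^ m / fact (m + 2)) * s ^ (m + 2) + 3 / (s * l) * energy (2 * s))"
proof -
  have eq: "2 * s ^ (m + 3) * avg_deriv s = (LINT x|lborel. (x \<bullet> grad u x) * weight 2 s x)"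
    using s wint_laplacian[OF smooth, of 2 s] by (simp add: avg_deriv_def wavg_def)
  have int1: "integrable lborel (\<lambda>x::real^'n. 1 * weight 2 s x)"
    by (intro integrable_weight continuous_intros) simp
  have int2: "integrable lborel (\<lambda>x. (norm (grad u x))\<^sup>2 * weight 3 (2 * s) x)"
    by (intro integrable_weight continuous_intros) simp
  have int3: "integrable lborel (\<lambda>x. (x \<bullet> grad u x) * weight 2 s x)"
    by (intro integrable_weight continuous_intros) simp
  have ptw: "\<bar>(x \<bullet> grad u x) * weight 2 s x\<bar>
      \<le> sqrt s / 2 * (l * (1 * weight 2 s x) + 3 / (s * l) * ((norm (grad u x))\<^sup>2 * weight 3 (2 * s) x))" for x
  proof (cases "x \<bullet> x < s")
    case True
    then have "norm x \<le> sqrt s" by (simp add: norm_eq_sqrt_inner)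
    then have "\<bar>x \<bullet> grad u x\<bar> \<le> sqrt s * norm (grad u x)"
      using Cauchy_Schwarz_ineq2[of x "grad u x"] mult_right_mono[of "norm x" "sqrt s" "norm (grad u x)"] by auto
    also have "\<dots> \<le> sqrt s * ((l + (norm (grad u x))\<^sup>2 / l) / 2)"
    proof (rule mult_left_mono)
      have "0 \<le> (l - norm (grad u x))\<^sup>2 / l" using l by simp
      also have "\<dots> = l + (norm (grad u x))\<^sup>2 / l - 2 * norm (grad u x)"
        using l by (simp add: power2_eq_square field_simps)
      finally show "norm (grad u x) \<le> (l + (norm (grad u x))\<^sup>2 / l) / 2" by simp
    qed (use s in simp)
    finally have "\<bar>x \<bullet> grad u x\<bar> * weight 2 s x \<le> sqrt s * ((l + (norm (grad u x))\<^sup>2 / l) / 2) * weight 2 s x"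
      by (rule mult_right_mono) simp
    also have "\<dots> = sqrt s / 2 * (l * weight 2 s x + (norm (grad u x))\<^sup>2 / l * weight 2 s x)"
      by (simp add: algebra_simps)
    also have "\<dots> \<le> sqrt s / 2 * (l * weight 2 s x + (norm (grad u x))\<^sup>2 / l * (3 / s * weight 3 (2 * s) x))"
      using s l by (intro mult_left_mono add_left_mono weight_2_le_weight_3) auto
    finally show ?thesis by (simp add: abs_mult mult_ac)
  next
    case False
    then show ?thesis using s l by (simp add: weight_eq_0)
  qed
  have "\<bar>2 * s ^ (m + 3) * avg_deriv s\<bar> \<le> (LINT x|lborel. \<bar>(x \<bullet> grad u x) * weight 2 s x\<bar>)"
    unfolding eq by (rule integral_abs_bound)
  also have "\<dots> \<le> (LINT x|lborel. sqrt s / 2 * (l * (1 * weight 2 s x) + 3 / (s * l) * ((norm (grad u x))\<^sup>2 * weight 3 (2 * s) x)))"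
    by (intro integral_mono integrable_abs int3 integrable_mult_right Bochner_Integration.integrable_add int1 int2 ptw)
  also have "\<dots> = sqrt s / 2 * (l * wint 2 (\<lambda>x::real^'n. 1) s + 3 / (s * l) * energy (2 * s))"
    unfolding wint_def energy_def integral_mult_right_zero
    by (subst Bochner_Integration.integral_add) (use int1 int2 in auto)
  also have "wint 2 (\<lambda>x::real^'n. 1) s = (pi ^ m / fact (m + 2)) * s ^ (m + 2)"
    using wavg_const[OF dim s] s by (simp add: wavg_def field_simps)
  finally show ?thesis using s by (simp add: abs_mult mult_ac)
qed

text \<open>The quadratic gradient term of the scalar curvature makes polynomial growth of \<open>avg_deriv\<close> impossible.\<close>

lemma avg_deriv_not_polynomial:
  assumes a: "a \<noteq> 0"
  shows "\<not> ((\<lambda>s. avg_deriv s / s ^ d) \<longlongrightarrow> a) at_top"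
proof
  assume lim: "((\<lambda>s. avg_deriv s / s ^ d) \<longlongrightarrow> a) at_top"
  obtain C where C: "C \<ge> 0" "\<And>s. s > 0 \<Longrightarrow> energy s \<le> C * s ^ 3 - 4 * s ^ (m + 3) * avg_deriv s"
    using energy_bound by blast
  define c where "c = pi ^ m / (fact (m + 2) :: real)"
  define B where "B = \<bar>a\<bar> + 1"
  have abs_lim: "((\<lambda>s. \<bar>avg_deriv s / s ^ d\<bar>) \<longlongrightarrow> \<bar>a\<bar>) at_top" by (intro tendsto_intros lim)
  have "\<forall>\<^sub>F s in at_top. \<bar>avg_deriv s / s ^ d\<bar> < B"
    by (rule order_tendstoD(2)[OF abs_lim]) (simp add: B_def)
  moreover have "\<forall>\<^sub>F s in at_top. \<bar>avg_deriv s / s ^ d\<bar> > \<bar>a\<bar> / 2"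
    by (rule order_tendstoD(1)[OF abs_lim]) (use a in simp)
  ultimately have "\<forall>\<^sub>F s in at_top. s \<ge> 1 \<and> \<bar>avg_deriv s / s ^ d\<bar> < B \<and> \<bar>avg_deriv s / s ^ d\<bar> > \<bar>a\<bar> / 2"
    using eventually_ge_at_top[of 1] by (auto elim: eventually_elim2 intro: eventually_conj)
  then obtain s0 where s0: "\<And>s. s \<ge> s0 \<Longrightarrow> s \<ge> 1 \<and> \<bar>avg_deriv s / s ^ d\<bar> < B \<and> \<bar>avg_deriv s / s ^ d\<bar> > \<bar>a\<bar> / 2"
    unfolding eventually_at_top_linorder by blast
  \<comment> \<open>The factors 8, 2^(m+3) and 2^d come from evaluating s^3, s^(m+3) and s^d at 2s
    in the energy bound.\<close>
  define K where "K = c + 3 * (8 * C + 4 * 2 ^ (m + 3) * (B * 2 ^ d))"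
  have "sqrt s * \<bar>a\<bar> \<le> K" if ss: "s \<ge> s0" for s
  proof -
    have s: "s \<ge> 1" using s0 ss by blast
    define p where "p = s ^ (m + 3)"
    have p: "p > 0" "s ^ (m + 2) * s = p" "s ^ 3 \<le> p"
      using s by (auto simp: p_def power_add numeral_3_eq_3 intro!: power_increasing)
    \<comment> \<open>With l = s^d the upper estimate is of order s^(m+d+5/2), half a power of s
      below the size s^(m+d+3) of the left side. This gap is the contradiction.\<close>
    define l where "l = s ^ d"
    have l: "l \<ge> 1" using s by (simp add: l_def)
    have "2 * s \<ge> s0" "s > 0" using s ss by auto
    then have "\<bar>avg_deriv (2 * s) / (2 * s) ^ d\<bar> < B" using s0 by blast
    then have D2: "\<bar>avg_deriv (2 * s)\<bar> \<le> B * 2 ^ d * l"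
      using s by (simp add: l_def abs_divide pos_divide_less_eq power_mult_distrib mult_ac)
    have "energy (2 * s) \<le> C * (2 * s) ^ 3 + 4 * (2 * s) ^ (m + 3) * \<bar>avg_deriv (2 * s)\<bar>"
    proof -
      have "- (4 * (2 * s) ^ (m + 3) * avg_deriv (2 * s)) \<le> 4 * (2 * s) ^ (m + 3) * \<bar>avg_deriv (2 * s)\<bar>"
        using s mult_left_mono[of "- avg_deriv (2 * s)" "\<bar>avg_deriv (2 * s)\<bar>" "4 * (2 * s) ^ (m + 3)"] by auto
      then show ?thesis using C(2)[of "2 * s"] s by linarith
    qed
    also have "\<dots> = 8 * C * s ^ 3 + 4 * 2 ^ (m + 3) * p * \<bar>avg_deriv (2 * s)\<bar>"
      by (simp add: p_def power_mult_distrib)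
    also have "\<dots> \<le> 8 * C * (p * l) + 4 * 2 ^ (m + 3) * p * (B * 2 ^ d * l)"
    proof (intro add_mono mult_left_mono D2)
      have "s ^ 3 * 1 \<le> p * l" using p l by (intro mult_mono) auto
      then show "s ^ 3 \<le> p * l" by simp
    qed (use C p in auto)
    also have "\<dots> = p * l * (8 * C + 4 * 2 ^ (m + 3) * (B * 2 ^ d))"
      by (simp add: algebra_simps)
    finally have E: "energy (2 * s) \<le> p * l * (8 * C + 4 * 2 ^ (m + 3) * (B * 2 ^ d))" .
    have "\<bar>a\<bar> / 2 * l \<le> \<bar>avg_deriv s\<bar>"
      using s0[OF ss] s by (simp add: l_def abs_divide pos_less_divide_eq less_imp_le)
    then have "2 * p * (\<bar>a\<bar> / 2 * l) \<le> 2 * p * \<bar>avg_deriv s\<bar>" using p by (intro mult_left_mono) auto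
    also have "\<dots> \<le> sqrt s / 2 * (l * c * s ^ (m + 2) + 3 / (s * l) * energy (2 * s))"
      using avg_deriv_le_energy[of s l] s l by (simp add: p_def c_def)
    also have "\<dots> \<le> sqrt s / 2 * (l * c * s ^ (m + 2) + 3 / (s * l) * (p * l * (8 * C + 4 * 2 ^ (m + 3) * (B * 2 ^ d))))"
      using s l by (intro mult_left_mono add_left_mono E) auto
    also have "\<dots> = sqrt s / 2 * (p / s) * (l * c + 3 * (8 * C + 4 * 2 ^ (m + 3) * (B * 2 ^ d)))"
      using s l p(2) by (simp add: field_simps)
    also have "\<dots> \<le> sqrt s / 2 * (p / s) * (l * K)"
    proof (rule mult_left_mono)
      have "3 * (8 * C + 4 * 2 ^ (m + 3) * (B * 2 ^ d)) \<ge> 0" using C by (simp add: B_def)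
      from mult_right_mono[OF l this] show "l * c + 3 * (8 * C + 4 * 2 ^ (m + 3) * (B * 2 ^ d)) \<le> l * K"
        by (simp add: K_def distrib_left)
    qed (use s p in auto)
    finally have "p * l * \<bar>a\<bar> \<le> p * l * (sqrt s / 2 * K / s)" by (simp add: mult_ac)
    then have "\<bar>a\<bar> \<le> sqrt s / 2 * K / s" using p l by (subst (asm) mult_le_cancel_left_pos) auto
    then have "sqrt s * \<bar>a\<bar> \<le> sqrt s * (sqrt s / 2 * K / s)" using s by (intro mult_left_mono) auto
    also have "\<dots> = K / 2" using s by (simp add: field_simps)
    also have "\<dots> \<le> K"
    proof -
      have "K \<ge> 0"
        unfolding K_def c_def B_def using C(1) by (intro add_nonneg_nonneg mult_nonneg_nonneg) auto
      then show ?thesis by simp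
    qed
    finally show ?thesis .
  qed
  then have "\<forall>\<^sub>F s in at_top. sqrt s * \<bar>a\<bar> \<le> K"
    unfolding eventually_at_top_linorder by blast
  moreover have "\<forall>\<^sub>F s in at_top. sqrt s * \<bar>a\<bar> > K"
  proof -
    have "filterlim (\<lambda>s. sqrt s * \<bar>a\<bar>) at_top at_top"
      using a sqrt_at_top by (intro filterlim_at_top_mult_tendsto_pos[OF tendsto_const]) auto
    then show ?thesis unfolding filterlim_at_top_dense by blast
  qed
  ultimately have "\<forall>\<^sub>F s :: real in at_top. False" by eventually_elim auto
  then show False by simp
qed

section \<open>Logarithmic behaviour of the averages\<close>

lemma avg_deriv_asymptotics:
  "((\<lambda>s. s * avg_deriv s) \<longlongrightarrow> - total / (4 ^ m * fact (m + 2) * fact (m - 1))) at_top"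
  using avg_deriv_dichotomy avg_deriv_not_polynomial by blast

text \<open>Minus the limit of s A'(s), so that A(s) behaves like -\<theta> ln s. As
  \<open>wavg\<close> is normalised only up to the factor \<open>c\<close>, defined next, the true
  rate for means is \<theta>/c.\<close>

definition \<theta> :: real where
  "\<theta> = total / (4 ^ m * fact (m + 2) * fact (m - 1))"

definition c :: real where
  "c = pi ^ m / fact (m + 2)"

lemma c_pos: "c > 0"
  by (simp add: c_def)

lemma wint_2_const: "s > 0 \<Longrightarrow> wint 2 (\<lambda>x::real^'n. b) s = b * c * s ^ (m + 2)"
  using wavg_const[OF dim, of s] wint_cmult[of 2 b "\<lambda>x::real^'n. 1" s] by (simp add: wavg_def c_def field_simps)

lemma avg_deriv_tendsto: "((\<lambda>s. s * avg_deriv s) \<longlongrightarrow> - \<theta>) at_top"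
  using avg_deriv_asymptotics by (simp add: \<theta>_def)

text \<open>Since s^m A'(s) is bounded above and m is at least 2, s A'(s) is at most a multiple of
  1/s.\<close>

lemma \<theta>_nonneg: "\<theta> \<ge> 0"
proof -
  obtain C where C: "\<And>s. s > 0 \<Longrightarrow> s ^ m * avg_deriv s \<le> C"
    using average_bounded_derivative_le by blast
  obtain j where j: "m = Suc (Suc j)" using m by (metis add_2_eq_Suc le_Suc_ex)
  have "- \<theta> \<le> 0"
  proof (rule tendsto_le[OF _ _ avg_deriv_tendsto])
    show "((\<lambda>s. \<bar>C\<bar> / s) \<longlongrightarrow> 0) at_top" by real_asymp
    show "\<forall>\<^sub>F s in at_top. s * avg_deriv s \<le> \<bar>C\<bar> / s"
      using eventually_ge_at_top[of 1]
    proof eventually_elim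
      case (elim s)
      have "s ^ Suc j * (s * avg_deriv s) \<le> \<bar>C\<bar>" using C[of s] elim by (simp add: j mult_ac)
      then have "s * avg_deriv s \<le> \<bar>C\<bar> / s ^ Suc j" using elim by (simp add: pos_le_divide_eq mult.commute)
      also have "\<dots> \<le> \<bar>C\<bar> / s" using elim power_increasing[of 1 "Suc j" s]
        by (intro divide_left_mono) auto
      finally show ?case .
    qed
  qed simp
  then show ?thesis by simp
qed

text \<open>The argument r^2/4 belongs to balls of radius r/2, the scale used around a point at
  distance r. The factor 2 comes from ln(r^2/4) being asymptotic to 2 ln r.\<close>

lemma average_over_ln_tendsto: "((\<lambda>r. wavg m 2 u (r\<^sup>2 / 4) / ln r) \<longlongrightarrow> - 2 * \<theta>) at_top"
proof -
  have "((\<lambda>s. wavg m 2 u s / ln s) \<longlongrightarrow> - \<theta>) at_top"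
  proof (rule lhospital_at_top_at_top)
    show "LIM s at_top. ln s :> (at_top :: real filter)" by real_asymp
    show "\<forall>\<^sub>F s in at_top. (wavg m 2 u has_real_derivative avg_deriv s) (at s)"
      using eventually_gt_at_top[of 0] by eventually_elim (rule DERIV_average)
    show "\<forall>\<^sub>F s in at_top. (ln has_real_derivative 1 / s) (at s)"
      using eventually_gt_at_top[of 0] by eventually_elim (auto intro!: derivative_eq_intros)
    show "\<forall>\<^sub>F s :: real in at_top. 1 / s \<noteq> 0"
      using eventually_gt_at_top[of 0] by eventually_elim auto
    show "((\<lambda>s. avg_deriv s / (1 / s)) \<longlongrightarrow> - \<theta>) at_top"
      using avg_deriv_tendsto by (simp add: mult.commute)
  qed
  moreover have "LIM r at_top. r\<^sup>2 / 4 :> (at_top :: real filter)" by real_asymp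
  ultimately have "((\<lambda>r. wavg m 2 u (r\<^sup>2 / 4) / ln (r\<^sup>2 / 4)) \<longlongrightarrow> - \<theta>) at_top"
    by (rule filterlim_compose)
  moreover have "((\<lambda>r::real. ln (r\<^sup>2 / 4) / ln r) \<longlongrightarrow> 2) at_top" by real_asymp
  ultimately have "((\<lambda>r. wavg m 2 u (r\<^sup>2 / 4) / ln (r\<^sup>2 / 4) * (ln (r\<^sup>2 / 4) / ln r)) \<longlongrightarrow> - \<theta> * 2) at_top"
    by (rule tendsto_mult)
  then have "((\<lambda>r. wavg m 2 u (r\<^sup>2 / 4) / ln r) \<longlongrightarrow> - \<theta> * 2) at_top"
  proof (rule Lim_transform_eventually)
    show "\<forall>\<^sub>F r in at_top. wavg m 2 u (r\<^sup>2 / 4) / ln (r\<^sup>2 / 4) * (ln (r\<^sup>2 / 4) / ln r) = wavg m 2 u (r\<^sup>2 / 4) / ln r"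
      using eventually_gt_at_top[of 2]
    proof eventually_elim
      case (elim r)
      have "r\<^sup>2 > 2\<^sup>2" using elim by (intro power_strict_mono) auto
      then have "ln (r\<^sup>2 / 4) > 0" by (intro ln_gt_zero) simp
      then show ?case by simp
    qed
  qed
  then show ?thesis by (simp add: mult.commute)
qed

text \<open>Now that A' is O(1/s), \<open>energy_bound\<close> gives the order s^(m+2), which is the
  scaling of a gradient of size 1/|x|.\<close>

lemma energy_growth:
  "\<exists>C s1. s1 \<ge> 1 \<and> C \<ge> 0 \<and> (\<forall>s\<ge>s1. energy s \<le> C * s ^ (m + 2))"
proof -
  obtain C where C: "C \<ge> 0" "\<And>s. s > 0 \<Longrightarrow> energy s \<le> C * s ^ 3 - 4 * s ^ (m + 3) * avg_deriv s"
    using energy_bound by blast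
  have "((\<lambda>s. \<bar>s * avg_deriv s\<bar>) \<longlongrightarrow> \<bar>- \<theta>\<bar>) at_top" by (intro tendsto_intros avg_deriv_tendsto)
  then have "\<forall>\<^sub>F s in at_top. \<bar>s * avg_deriv s\<bar> < \<bar>\<theta>\<bar> + 1" by (rule order_tendstoD) simp
  then obtain s0 where s0: "\<And>s. s \<ge> s0 \<Longrightarrow> \<bar>s * avg_deriv s\<bar> < \<bar>\<theta>\<bar> + 1"
    unfolding eventually_at_top_linorder by blast
  have "energy s \<le> (C + 4 * (\<bar>\<theta>\<bar> + 1)) * s ^ (m + 2)" if s: "s \<ge> max s0 1" for s
  proof -
    have "C * s ^ 3 \<le> C * s ^ (m + 2)"
      using s C(1) m by (intro mult_left_mono power_increasing) auto
    moreover have "- (4 * s ^ (m + 3) * avg_deriv s) = s ^ (m + 2) * (4 * - (s * avg_deriv s))"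
      by (simp add: power_add numeral_3_eq_3 power2_eq_square)
    moreover have "\<dots> \<le> s ^ (m + 2) * (4 * (\<bar>\<theta>\<bar> + 1))"
      using s s0[of s] by (intro mult_left_mono) (auto simp: abs_less_iff)
    moreover have "energy s \<le> C * s ^ 3 - 4 * s ^ (m + 3) * avg_deriv s" using C(2) s by simp
    ultimately have "energy s \<le> C * s ^ (m + 2) + s ^ (m + 2) * (4 * (\<bar>\<theta>\<bar> + 1))" by linarith
    then show ?thesis unfolding distrib_right by (simp only: mult.commute)
  qed
  then show ?thesis
    by (intro exI[of _ "C + 4 * (\<bar>\<theta>\<bar> + 1)"] exI[of _ "max s0 1"]) (use C(1) in auto)
qed

text \<open>The ball is moved from the origin to x along a segment. The derivative along the way is
  an integral of x times the gradient of u, controlled by the energy on one large ball about the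
  origin that contains all the translates.\<close>

lemma average_translate_bounded:
  obtains C r1 where "r1 > 0" "\<And>x. norm x \<ge> r1 \<Longrightarrow>
    \<bar>wavg m 2 (\<lambda>y. u (x + y)) ((norm x)\<^sup>2 / 4) - wavg m 2 u ((norm x)\<^sup>2 / 4)\<bar> \<le> C"
proof -
  obtain C s1 where C: "s1 \<ge> 1" "C \<ge> 0" "\<And>s. s \<ge> s1 \<Longrightarrow> energy s \<le> C * s ^ (m + 2)"
    using energy_growth by metis
  have "\<bar>wavg m 2 (\<lambda>y. u (x + y)) ((norm x)\<^sup>2 / 4) - wavg m 2 u ((norm x)\<^sup>2 / 4)\<bar> \<le> c / 2 + 2 * C * 18 ^ (m + 2)"
    if x: "norm x \<ge> s1 * 2" for x
  proof -
    define s where "s = (norm x)\<^sup>2 / 4"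
    have "s1 * s1 \<le> (norm x / 2) * (norm x / 2)" using x C(1) by (intro mult_mono) auto
    then have "s1 * s1 \<le> s" by (simp add: s_def power2_eq_square)
    moreover have "s1 \<le> s1 * s1" using C(1) mult_left_mono[of 1 s1 s1] by simp
    ultimately have s: "s \<ge> s1" "s > 0" using C(1) by linarith+
    have x2: "(norm x)\<^sup>2 = 4 * s" by (simp add: s_def)
    define J where "J = (\<lambda>t. LINT y|lborel. u (y + t *\<^sub>R x) * weight 2 s y)"
    define J' where "J' = (\<lambda>t. LINT y|lborel. (x \<bullet> grad u (y + t *\<^sub>R x)) * weight 2 s y)"
    have ct: "continuous_on UNIV (\<lambda>y. grad u (y + t *\<^sub>R x))" for t
      by (rule continuous_on_compose2[OF cont_grad]) (auto intro!: continuous_intros)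
    obtain a where a: "cball (0::real^'n) (sqrt \<bar>s\<bar>) \<subseteq> cbox (-a) a"
      using bounded_subset_cbox_symmetric[OF bounded_cball] by blast
    have der: "(J has_real_derivative J' t) (at t)" if t: "0 \<le> t" "t \<le> 1" for t
      unfolding J_def J'_def
    proof (rule lborel_integral_leibniz[of UNIV _ _ _ "-a" a])
      show "((\<lambda>t. u (y + t *\<^sub>R x) * weight 2 s y) has_real_derivative (x \<bullet> grad u (y + t *\<^sub>R x)) * weight 2 s y) (at t)" for t y
        by (intro DERIV_cmult_right DERIV_line smooth_differentiable smooth)
      show "continuous_on UNIV (\<lambda>y. u (y + t *\<^sub>R x) * weight 2 s y)" for t
        by (intro continuous_intros continuous_on_compose2[OF cont_u]) auto
      show "continuous_on (UNIV \<times> UNIV) (\<lambda>(t, y). (x \<bullet> grad u (y + t *\<^sub>R x)) * weight 2 s y)"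
        unfolding case_prod_beta
        by (intro continuous_intros continuous_on_compose2[OF cont_grad]) auto
      fix t y assume "y \<notin> cbox (- a) a"
      then have "norm y > sqrt \<bar>s\<bar>" using a by (meson linorder_not_le mem_cball_0 subsetD)
      then show "u (y + t *\<^sub>R x) * weight 2 s y = 0" using norm_gt_imp_weight_eq_0[of 2 s y] by simp
    qed auto
    have bound: "\<bar>J' t\<bar> \<le> (c / 2 + 2 * C * 18 ^ (m + 2)) * s ^ (m + 2)" if t: "0 < t" "t < 1" for t
    proof -
      let ?z = "\<lambda>y. y + t *\<^sub>R x"
      have ptw: "\<bar>(x \<bullet> grad u (?z y)) * weight 2 s y\<bar>
          \<le> 1 / 2 * (1 * weight 2 s y) + 2 * ((norm (grad u (?z y)))\<^sup>2 * weight 3 (18 * s) (?z y))" for y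
      proof (cases "y \<bullet> y < s")
        case True
        have "\<bar>x \<bullet> grad u (?z y)\<bar> \<le> norm x * norm (grad u (?z y))" by (rule Cauchy_Schwarz_ineq2)
        also have "\<dots> \<le> 1 / 2 + (norm x)\<^sup>2 * (norm (grad u (?z y)))\<^sup>2 / 2"
          using sum_squares_bound[of 1 "norm x * norm (grad u (?z y))"] by (simp add: power_mult_distrib)
        also have "\<dots> = 1 / 2 + 2 * (norm (grad u (?z y)))\<^sup>2 * s" by (simp add: x2)
        finally have "\<bar>x \<bullet> grad u (?z y)\<bar> * weight 2 s y \<le> (1 / 2 + 2 * (norm (grad u (?z y)))\<^sup>2 * s) * weight 2 s y"
          by (rule mult_right_mono) simp
        \<comment> \<open>The moved ball stays within radius 3 \<open>sqrt s\<close>, so |z|^2 is at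
          most 9s there; the parameter 18s leaves a margin of 9s in the weight.\<close>
        moreover have "s * weight 2 s y \<le> weight 3 (18 * s) (?z y)"
        proof -
          have "norm y \<le> sqrt s" using True by (simp add: norm_eq_sqrt_inner)
          moreover have "norm (t *\<^sub>R x) \<le> 2 * sqrt s"
          proof -
            have "norm x = 2 * sqrt s" by (simp add: s_def real_sqrt_divide)
            moreover have "t * norm x \<le> norm x" using t by (intro mult_left_le_one_le) auto
            ultimately show ?thesis using t by simp
          qed
          ultimately have "norm (?z y) \<le> 3 * sqrt s" using norm_triangle_ineq[of y "t *\<^sub>R x"] by linarith
          then have "(norm (?z y))\<^sup>2 \<le> (3 * sqrt s)\<^sup>2" by (intro power_mono) auto
          then have "?z y \<bullet> ?z y \<le> 9 * s" using s by (simp add: power_mult_distrib power2_norm_eq_inner)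
          then have "(9 * s) ^ 3 \<le> max 0 (18 * s - ?z y \<bullet> ?z y) ^ 3" using s by (intro power_mono) auto
          moreover have "s * (s\<^sup>2 / 2) \<le> (9 * s) ^ 3 / 6"
            using s by (simp add: power_mult_distrib power2_eq_square power3_eq_cube)
          moreover have "weight 2 s y \<le> s\<^sup>2 / 2" using weight_le[of s 2 y] s by simp
          then have "s * weight 2 s y \<le> s * (s\<^sup>2 / 2)" using s by (intro mult_left_mono) auto
          ultimately show ?thesis by (simp add: weight_def fact_numeral)
        qed
        then have "2 * (norm (grad u (?z y)))\<^sup>2 * (s * weight 2 s y) \<le> 2 * (norm (grad u (?z y)))\<^sup>2 * weight 3 (18 * s) (?z y)"
          by (rule mult_left_mono) simp
        ultimately show ?thesis by (simp add: abs_mult algebra_simps)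
      next
        case False
        then show ?thesis by (simp add: weight_eq_0)
      qed
      have int1: "integrable lborel (\<lambda>y::real^'n. 1 * weight 2 s y)"
        by (intro integrable_weight continuous_intros) simp
      have meas: "(\<lambda>z. (norm (grad u z))\<^sup>2 * weight 3 (18 * s) z) \<in> borel_measurable borel"
        by (intro borel_measurable_continuous_onI continuous_intros)
      have int0: "integrable lborel (\<lambda>z. (norm (grad u z))\<^sup>2 * weight 3 (18 * s) z)"
        by (intro integrable_weight continuous_intros) simp
      then have "integrable (distr lborel borel ((+) (t *\<^sub>R x))) (\<lambda>z. (norm (grad u z))\<^sup>2 * weight 3 (18 * s) z)"
        by (simp add: lborel_distr_plus)
      then have int2: "integrable lborel (\<lambda>y. (norm (grad u (?z y)))\<^sup>2 * weight 3 (18 * s) (?z y))"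
        by (subst (asm) integrable_distr_eq) (use meas in \<open>auto simp: add.commute\<close>)
      have int3: "integrable lborel (\<lambda>y. (x \<bullet> grad u (?z y)) * weight 2 s y)"
        by (intro integrable_weight continuous_intros ct) simp
      have "\<bar>J' t\<bar> \<le> (LINT y|lborel. \<bar>(x \<bullet> grad u (?z y)) * weight 2 s y\<bar>)"
        unfolding J'_def by (rule integral_abs_bound)
      also have "\<dots> \<le> (LINT y|lborel. 1 / 2 * (1 * weight 2 s y) + 2 * ((norm (grad u (?z y)))\<^sup>2 * weight 3 (18 * s) (?z y)))"
        by (intro integral_mono integrable_abs int3 integrable_mult_right Bochner_Integration.integrable_add int1 int2 ptw)
      also have "\<dots> = 1 / 2 * wint 2 (\<lambda>x::real^'n. 1) s + 2 * (LINT y|lborel. (norm (grad u (?z y)))\<^sup>2 * weight 3 (18 * s) (?z y))"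
        unfolding wint_def
        by (subst Bochner_Integration.integral_add) (use int1 int2 in auto)
      also have "(LINT y|lborel. (norm (grad u (?z y)))\<^sup>2 * weight 3 (18 * s) (?z y)) = energy (18 * s)"
        using lborel_integral_translate[OF meas, of "t *\<^sub>R x"] by (simp add: energy_def wint_def add.commute)
      also have "energy (18 * s) \<le> C * (18 * s) ^ (m + 2)" using C(3)[of "18 * s"] s by simp
      finally show ?thesis
        using s by (simp only: wint_2_const power_mult_distrib) (simp add: algebra_simps)
    qed
    obtain z where z: "0 < z" "z < 1" "J 1 - J 0 = (1 - 0) * J' z"
      using MVT2[of 0 1 J J'] der by auto
    then have "\<bar>J 1 - J 0\<bar> \<le> (c / 2 + 2 * C * 18 ^ (m + 2)) * s ^ (m + 2)" using bound by simp
    moreover have "wavg m 2 (\<lambda>y. u (x + y)) s - wavg m 2 u s = (J 1 - J 0) / s ^ (m + 2)"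
      by (simp add: J_def wavg_def wint_def add.commute diff_divide_distrib)
    ultimately show ?thesis
      using s by (simp add: abs_divide pos_divide_le_eq flip: s_def)
  qed
  then show thesis using C(1) by (intro that[of "s1 * 2"]) auto
qed

text \<open>The ball of radius |x|/2 about x avoids the ball of radius R, so u is superharmonic on
  it: its averages decrease in s, and as s tends to 0 they tend to c u(x).\<close>

lemma average_le_center:
  assumes x: "norm x \<ge> 2 * R"
  shows "wavg m 2 (\<lambda>y. u (x + y)) ((norm x)\<^sup>2 / 4) \<le> c * u x"
proof -
  define s where "s = (norm x)\<^sup>2 / 4"
  define v where "v = (\<lambda>y. u (x + y))"
  have s: "s > 0" using x R by (auto simp: s_def)
  have v: "smooth v" unfolding v_def by (rule smooth_translate[OF smooth])
  have lap: "laplacian v y \<le> 0" if "y \<bullet> y < s" for y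
  proof -
    have "(norm y)\<^sup>2 \<le> (norm x / 2)\<^sup>2" using that by (simp add: s_def power2_norm_eq_inner power_divide)
    then have "norm y \<le> norm x / 2" by (rule power2_le_imp_le) simp
    then have *: "norm (x + y) \<ge> R" using x norm_diff_ineq[of x y] by linarith
    have "laplacian u (x + y) \<le> 0"
    proof -
      have "0 \<le> (real m - 1) * (norm (grad u (x + y)))\<^sup>2"
        by (intro mult_nonneg_nonneg) (use m in auto)
      with scal[OF *] show ?thesis by linarith
    qed
    then show ?thesis by (simp add: v_def laplacian_translate smooth)
  qed
  have decr: "wavg m 2 v s \<le> wavg m 2 v t" if t: "0 < t" "t \<le> s" for t
  proof (rule DERIV_nonpos_imp_nonincreasing[OF t(2)])
    fix r assume r: "t \<le> r" "r \<le> s"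
    have "wint 3 (laplacian v) r \<le> wint 3 (\<lambda>_::real^'n. 0) r"
      by (rule wint_mono) (use lap r in \<open>auto intro!: smooth_continuous smooth_laplacian v\<close>)
    then have "wavg m 3 (laplacian v) r / 4 \<le> 0"
      using t r by (simp add: wavg_def wint_def divide_le_0_iff)
    then show "\<exists>y. (wavg m 2 v has_real_derivative y) (at r) \<and> y \<le> 0"
      using DERIV_wavg[OF v _ dim, of 2 r] t r by auto
  qed
  have "wavg m 2 v s \<le> c * v 0"
    unfolding c_def
  proof (rule tendsto_lowerbound[OF wavg_tendsto_center[OF smooth_continuous[OF v] dim]])
    show "\<forall>\<^sub>F t in at_right 0. wavg m 2 v s \<le> wavg m 2 v t"
      using eventually_at_right_real[OF s] by eventually_elim (use decr in auto)
  qed simp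
  then show ?thesis by (simp add: v_def s_def)
qed

text \<open>Below, u(x) is bounded by the average at scale |x|/2. Above, a bound u > b ln |x| near
  infinity with too large a b would pass to these averages and contradict their asymptotics.\<close>

lemma Liminf_eq:
  "Liminf at_infinity (\<lambda>x. ereal (u x / ln (norm x))) = ereal (- (2 * \<theta> / c))"
proof -
  let ?g = "\<lambda>x. wavg m 2 u ((norm x)\<^sup>2 / 4)"
  obtain C r1 where C: "r1 > 0" "\<And>x. norm x \<ge> r1 \<Longrightarrow>
    \<bar>wavg m 2 (\<lambda>y. u (x + y)) ((norm x)\<^sup>2 / 4) - ?g x\<bar> \<le> C"
    using average_translate_bounded by blast
  \<comment> \<open>Bounded errors b disappear after division by ln r; dividing by c turns the
    average into a mean.\<close>
  have avg: "((\<lambda>r. (wavg m 2 u (r\<^sup>2 / 4) + b) / c / ln r) \<longlongrightarrow> - (2 * \<theta> / c)) at_top" for b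
  proof -
    have "((\<lambda>r. wavg m 2 u (r\<^sup>2 / 4) / ln r + b / ln r) \<longlongrightarrow> - 2 * \<theta> + 0) at_top"
      by (intro tendsto_add average_over_ln_tendsto) real_asymp
    then have "((\<lambda>r. (wavg m 2 u (r\<^sup>2 / 4) / ln r + b / ln r) / c) \<longlongrightarrow> (- 2 * \<theta> + 0) / c) at_top"
      using c_pos by (intro tendsto_divide tendsto_const) auto
    then show ?thesis by (simp add: add_divide_distrib mult.commute)
  qed
  have "Liminf at_infinity (\<lambda>x::real^'n. ereal ((?g x + - C) / c / ln (norm x))) = ereal (- (2 * \<theta> / c))"
    by (intro lim_imp_Liminf trivial_limit_at_infinity tendsto_ereal
        filterlim_compose[OF avg] filterlim_norm_at_top)
  moreover have "Liminf at_infinity (\<lambda>x::real^'n. ereal ((?g x + - C) / c / ln (norm x)))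
      \<le> Liminf at_infinity (\<lambda>x. ereal (u x / ln (norm x)))"
  proof (rule Liminf_mono)
    show "\<forall>\<^sub>F x in at_infinity. ereal ((?g x + - C) / c / ln (norm x)) \<le> ereal (u x / ln (norm x))"
    proof (rule eventually_at_infinityI[of "max r1 (2 * R)"])
      fix x :: "real^'n" assume x: "max r1 (2 * R) \<le> norm x"
      have "?g x - C \<le> c * u x"
        using C(2)[of x] average_le_center[of x] x by (auto simp: abs_le_iff)
      then have "(?g x + - C) / c \<le> u x" using c_pos by (simp add: pos_divide_le_eq mult.commute)
      moreover have "ln (norm x) \<ge> 0" using x R by auto
      ultimately have "(?g x + - C) / c / ln (norm x) \<le> u x / ln (norm x)"
        by (rule divide_right_mono)
      then show "ereal ((?g x + - C) / c / ln (norm x)) \<le> ereal (u x / ln (norm x))"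
        by simp
    qed
  qed
  ultimately have "ereal (- (2 * \<theta> / c)) \<le> Liminf at_infinity (\<lambda>x. ereal (u x / ln (norm x)))"
    by simp
  moreover have "Liminf at_infinity (\<lambda>x. ereal (u x / ln (norm x))) \<le> ereal (- (2 * \<theta> / c))"
  proof (rule ccontr)
    assume "\<not> ?thesis"
    then have "ereal (- (2 * \<theta> / c)) < Liminf at_infinity (\<lambda>x. ereal (u x / ln (norm x)))"
      by (rule not_le_imp_less)
    from ereal_dense2[OF this] obtain b where b: "ereal (- (2 * \<theta> / c)) < ereal b"
      "ereal b < Liminf at_infinity (\<lambda>x. ereal (u x / ln (norm x)))"
      by blast
    from less_LiminfD[OF b(2)] obtain r0 where r0: "\<And>x. norm x \<ge> r0 \<Longrightarrow> b < u x / ln (norm x)"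
      unfolding eventually_at_infinity by auto
    have "b * ln r \<le> (wavg m 2 u (r\<^sup>2 / 4) + (C + \<bar>b\<bar> * c * ln 2)) / c" if r: "r \<ge> max r1 (2 * max r0 2)" for r
    proof -
      obtain x :: "real^'n" where x: "norm x = r"
        using vector_choose_size[of r] r C(1) by auto
      \<comment> \<open>On the ball of radius r/2 about x the norm lies between r/2 and 2r, so its
        logarithm differs from ln r by at most ln 2; the absolute value of b covers both
        signs.\<close>
      have low: "u (x + y) \<ge> b * ln r - \<bar>b\<bar> * ln 2" if "y \<bullet> y < r\<^sup>2 / 4" for y
      proof -
        have "(norm y)\<^sup>2 \<le> (r / 2)\<^sup>2" using that by (simp add: power2_norm_eq_inner power_divide)
        then have "norm y \<le> r / 2" by (rule power2_le_imp_le) (use r in auto)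
        then have n: "norm (x + y) \<ge> r / 2" "norm (x + y) \<le> 2 * r"
          using norm_diff_ineq[of x y] norm_triangle_ineq[of x y] x r by auto
        then have "norm (x + y) \<ge> max r0 2" using r by auto
        then have pos: "ln (norm (x + y)) > 0" "b < u (x + y) / ln (norm (x + y))"
          using r0[of "x + y"] by (auto intro!: ln_gt_zero)
        have "ln (norm (x + y)) \<le> ln (2 * r)" "ln (norm (x + y)) \<ge> ln (r / 2)"
          using n r by (auto intro!: ln_mono)
        then have "\<bar>ln (norm (x + y)) - ln r\<bar> \<le> ln 2"
        proof -
          have "r > 0" using r by linarith
          moreover have "ln (2 * r) = ln 2 + ln r" "ln (r / 2) = ln r - ln 2"
            using \<open>r > 0\<close> by (auto simp: ln_mult ln_div)
          ultimately show ?thesis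
            using \<open>ln (norm (x + y)) \<le> ln (2 * r)\<close> \<open>ln (norm (x + y)) \<ge> ln (r / 2)\<close>
            by linarith
        qed
        then have "\<bar>b * (ln (norm (x + y)) - ln r)\<bar> \<le> \<bar>b\<bar> * ln 2"
          unfolding abs_mult by (rule mult_left_mono) simp
        moreover have "b * ln (norm (x + y)) \<le> u (x + y)"
          using pos by (simp add: pos_less_divide_eq)
        ultimately show ?thesis by (simp add: abs_le_iff algebra_simps)
      qed
      have s: "r\<^sup>2 / 4 > 0" using r by auto
      have "wint 2 (\<lambda>y::real^'n. b * ln r - \<bar>b\<bar> * ln 2) (r\<^sup>2 / 4) \<le> wint 2 (\<lambda>y. u (x + y)) (r\<^sup>2 / 4)"
        by (rule wint_mono) (use low in \<open>auto intro!: smooth_continuous smooth_translate smooth\<close>)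
      then have "(b * ln r - \<bar>b\<bar> * ln 2) * c \<le> wavg m 2 (\<lambda>y. u (x + y)) (r\<^sup>2 / 4)"
        unfolding wint_2_const[OF s] wavg_def using s by (subst pos_le_divide_eq) auto
      also have "\<dots> \<le> wavg m 2 u (r\<^sup>2 / 4) + C"
        using C(2)[of x] x r by (auto simp: abs_le_iff)
      finally show ?thesis using c_pos by (simp add: pos_le_divide_eq algebra_simps)
    qed
    note le = this
    have "b \<le> - (2 * \<theta> / c)"
    proof (rule tendsto_lowerbound[OF avg])
      show "\<forall>\<^sub>F r in at_top. b \<le> (wavg m 2 u (r\<^sup>2 / 4) + (C + \<bar>b\<bar> * c * ln 2)) / c / ln r"
        using eventually_ge_at_top[of "max r1 (2 * max r0 2)"]
      proof eventually_elim
        case (elim r)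
        have "ln r > 0" using elim by auto
        then show ?case using le[OF elim] by (simp only: pos_le_divide_eq)
      qed
    qed simp
    then show False using b(1) by simp
  qed
  ultimately show ?thesis by (rule antisym[rotated])
qed

text \<open>With \<open>\<kappa> = m - 1\<close> the function \<open>exp (\<kappa> u)\<close> is superharmonic near infinity, whereas
  \<open>\<bar>x\<bar>\<^bsup>-2b\<^esup>\<close> is strictly subharmonic for \<open>b > \<kappa>\<close>.\<close>

lemma exp_lower_bound:
  assumes b: "b > real m - 1"
  obtains a where "a > 0" "\<And>x. norm x \<ge> R \<Longrightarrow> a * (x \<bullet> x) powr (- b) \<le> exp ((real m - 1) * u x)"
proof -
  define \<kappa> where "\<kappa> = real m - 1"
  have \<kappa>: "\<kappa> \<ge> 1" "b > \<kappa>" using m b by (auto simp: \<kappa>_def)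
  have cont_exp: "continuous_on S (\<lambda>x. exp (\<kappa> * u x))" for S
    by (intro continuous_intros continuous_on_subset[OF cont_u]) simp
  have "compact (sphere (0::real^'n) R)" "sphere (0::real^'n) R \<noteq> {}"
    using R by (auto simp: compact_sphere)
  then obtain xm where xm: "xm \<in> sphere 0 R" "\<And>x. x \<in> sphere 0 R \<Longrightarrow> exp (\<kappa> * u xm) \<le> exp (\<kappa> * u x)"
    using continuous_attains_inf[OF _ _ cont_exp] by metis
  \<comment> \<open>The largest factor for which the comparison function stays below the minimum of
    exp(\<kappa> u) on the sphere of radius R.\<close>
  define a where "a = exp (\<kappa> * u xm) / (R\<^sup>2) powr (- b)"
  have a: "a > 0" using R by (simp add: a_def)
  define Q where "Q = (\<lambda>x. exp (\<kappa> * u x) - a * (x \<bullet> x) powr (- b))"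
  have Q_sphere: "Q x \<ge> 0" if "norm x = R" for x
  proof -
    have "x \<bullet> x = R\<^sup>2" using that by (simp flip: power2_norm_eq_inner)
    then have "a * (x \<bullet> x) powr (- b) = exp (\<kappa> * u xm)" using R by (simp add: a_def)
    then show ?thesis using xm(2)[of x] that by (simp add: Q_def)
  qed
  have "Q x \<ge> 0" if x: "norm x \<ge> R" for x
  proof (rule ccontr)
    assume neg: "\<not> Q x \<ge> 0"
    have "((\<lambda>r::real. a * (r\<^sup>2) powr (- b)) \<longlongrightarrow> 0) at_top"
      using \<kappa> by real_asymp
    then have "\<forall>\<^sub>F r in at_top. a * (r\<^sup>2) powr (- b) < - Q x"
      by (rule order_tendstoD) (use neg in simp)
    then have "\<forall>\<^sub>F r in at_top. a * (r\<^sup>2) powr (- b) < - Q x \<and> r \<ge> norm x"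
      using eventually_ge_at_top by (rule eventually_conj)
    then obtain R2 where R2: "a * (R2\<^sup>2) powr (- b) < - Q x" "R2 \<ge> norm x"
      unfolding eventually_at_top_linorder by blast
    \<comment> \<open>R2 is so large that Q exceeds Q(x) on the outer sphere, and Q is nonnegative
      on the inner one. A minimum of Q over this shell, being at most Q(x) < 0, is therefore
      interior.\<close>
    define S where "S = cball (0::real^'n) R2 - ball 0 R"
    have mem_S: "y \<in> S \<longleftrightarrow> R \<le> norm y \<and> norm y \<le> R2" for y by (auto simp: S_def)
    have cont_Q: "continuous_on S Q"
      unfolding Q_def using R mem_S
      by (intro continuous_intros cont_exp) auto
    have "compact S" unfolding S_def by (intro compact_diff) auto
    moreover have "S \<noteq> {}" using x R2 mem_S[of x] by auto
    ultimately obtain y where y: "y \<in> S" "\<And>z. z \<in> S \<Longrightarrow> Q y \<le> Q z"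
      using continuous_attains_inf[OF _ _ cont_Q] by metis
    have Qy: "Q y \<le> Q x" using y(2) x R2 mem_S by blast
    then have "norm y \<noteq> R" using Q_sphere[of y] neg by auto
    moreover have "norm y \<noteq> R2"
    proof
      assume "norm y = R2"
      then have "y \<bullet> y = R2\<^sup>2" by (simp flip: power2_norm_eq_inner)
      then have "Q y = exp (\<kappa> * u y) - a * (R2\<^sup>2) powr (- b)" by (simp add: Q_def)
      then have "Q y > Q x" using R2(1) exp_gt_zero[of "\<kappa> * u y"] by linarith
      then show False using Qy by simp
    qed
    ultimately have inside: "R < norm y" "norm y < R2" using y(1) mem_S by force+
    define d where "d = min (norm y - R) (R2 - norm y)"
    have d: "d > 0" using inside by (simp add: d_def)
    define q where "q = y \<bullet> y"
    have q: "q > 0" using inside R by (auto simp: q_def)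
    define P1 where "P1 = q powr (- b - 1)"
    define P2 where "P2 = q powr (- b - 2)"
    \<comment> \<open>The pure second derivatives of Q at the interior minimum y, all nonnegative.
      Their sum is the Laplacian of Q, which turns out to be negative.\<close>
    define l where "l = (\<lambda>i. \<kappa> * exp (\<kappa> * u y) * (\<kappa> * (partial i u y)\<^sup>2 + partial i (partial i u) y)
        + 2 * a * b * (P1 - 2 * (b + 1) * (y $ i)\<^sup>2 * P2))"
    have l: "l i \<ge> 0" for i
    proof (rule second_derivative_nonneg_at_min[OF d])
      let ?e = "axis i 1 :: real^'n"
      let ?y = "\<lambda>t. y + t *\<^sub>R ?e"
      have near: "?y t \<in> S" "?y t \<noteq> 0" "?y t \<bullet> ?y t > 0" if "\<bar>t\<bar> < d" for t
      proof -
        have "norm (t *\<^sub>R ?e) < d" using that by simp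
        then have "R < norm (?y t)" "norm (?y t) < R2"
          using norm_diff_ineq[of y "t *\<^sub>R ?e"] norm_triangle_ineq[of y "t *\<^sub>R ?e"] by (auto simp: d_def)
        then show "?y t \<in> S" "?y t \<noteq> 0" "?y t \<bullet> ?y t > 0" using mem_S R by auto
      qed
      have dcomp: "((\<lambda>t. ?y t $ i) has_real_derivative 1) (at t)" for t
        by (auto intro!: derivative_eq_intros simp: axis_def)
      have dq: "((\<lambda>t. ?y t \<bullet> ?y t) has_real_derivative 2 * ?y t $ i) (at t)" for t
      proof -
        have "((\<lambda>t. ?y t \<bullet> ?y t) has_real_derivative 2 * (y \<bullet> ?e) + 2 * t * (?e \<bullet> ?e)) (at t)"
          by (simp only: inner_add_left inner_add_right inner_scaleR_left inner_scaleR_right)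
            (auto intro!: derivative_eq_intros simp: inner_commute algebra_simps)
        then show ?thesis by (simp add: inner_axis algebra_simps)
      qed
      have dpow: "((\<lambda>t. (?y t \<bullet> ?y t) powr r) has_real_derivative
          r * (?y t \<bullet> ?y t) powr (r - 1) * (2 * ?y t $ i)) (at t)" if "\<bar>t\<bar> < d" for t r
        by (rule DERIV_chain2[OF has_real_derivative_powr dq]) (use near that in auto)
      have du: "((\<lambda>t. v (?y t)) has_real_derivative partial i v (?y t)) (at t)" if "smooth v" for v t
        using DERIV_line[OF smooth_differentiable[OF that], of y ?e t] by simp
      have dexp: "((\<lambda>t. exp (\<kappa> * u (?y t))) has_real_derivative
          exp (\<kappa> * u (?y t)) * (\<kappa> * partial i u (?y t))) (at t)" for t
        by (intro DERIV_fun_exp DERIV_cmult du smooth)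
      show "((\<lambda>t. Q (?y t)) has_real_derivative exp (\<kappa> * u (?y t)) * (\<kappa> * partial i u (?y t))
          - a * (- b * (?y t \<bullet> ?y t) powr (- b - 1) * (2 * ?y t $ i))) (at t)" if "\<bar>t\<bar> < d" for t
        unfolding Q_def by (intro DERIV_diff dexp DERIV_cmult dpow that)
      let ?l = "(exp (\<kappa> * u (?y 0)) * (\<kappa> * partial i u (?y 0)) * (\<kappa> * partial i u (?y 0))
            + \<kappa> * partial i (partial i u) (?y 0) * exp (\<kappa> * u (?y 0)))
          - a * (- b * ((- b - 1) * (?y 0 \<bullet> ?y 0) powr (- b - 1 - 1) * (2 * ?y 0 $ i)) * (2 * ?y 0 $ i)
            + 2 * 1 * (- b * (?y 0 \<bullet> ?y 0) powr (- b - 1)))"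
      have "((\<lambda>t. exp (\<kappa> * u (?y t)) * (\<kappa> * partial i u (?y t))
          - a * (- b * (?y t \<bullet> ?y t) powr (- b - 1) * (2 * ?y t $ i))) has_real_derivative
          ?l) (at 0)"
        by (intro DERIV_diff DERIV_mult dexp DERIV_cmult dpow du smooth_partial smooth dcomp) (use d in simp)
      moreover have "?l = l i"
      proof -
        have "- b - 1 - 1 = - b - 2" by simp
        then show ?thesis
          unfolding l_def scaleR_zero_left add_0_right q_def[symmetric] P1_def[symmetric] P2_def[symmetric]
          by (simp add: P2_def[symmetric] algebra_simps power2_eq_square)
      qed
      ultimately show "((\<lambda>t. exp (\<kappa> * u (?y t)) * (\<kappa> * partial i u (?y t))
          - a * (- b * (?y t \<bullet> ?y t) powr (- b - 1) * (2 * ?y t $ i))) has_real_derivative l i) (at 0)"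
        by (simp only:)
      show "Q (?y 0) \<le> Q (?y t)" if "\<bar>t\<bar> < d" for t
        using y(2)[OF near(1)[OF that]] by simp
    qed
    have "(\<Sum>i\<in>UNIV. l i) = \<kappa> * exp (\<kappa> * u y) * (\<kappa> * (\<Sum>i\<in>UNIV. (partial i u y)\<^sup>2) + laplacian u y)
        + 2 * a * b * (real CARD('n) * P1 - 2 * (b + 1) * (\<Sum>i\<in>UNIV. (y $ i)\<^sup>2) * P2)"
      by (simp add: l_def laplacian_def sum.distrib sum_subtractf flip: sum_distrib_left sum_distrib_right)
    also have "(\<Sum>i\<in>UNIV. (partial i u y)\<^sup>2) = (norm (grad u y))\<^sup>2"
      unfolding power2_norm_eq_inner by (simp add: inner_vec_def grad_def power2_eq_square)
    also have "(\<Sum>i\<in>UNIV. (y $ i)\<^sup>2) = q"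
      by (simp add: q_def inner_vec_def power2_eq_square)
    \<comment> \<open>Here n = 2\<kappa> + 2 enters: n - 2(b + 1) = 2(\<kappa> - b), negative
      exactly for b > \<kappa>.\<close>
    also have "2 * a * b * (real CARD('n) * P1 - 2 * (b + 1) * q * P2) = 4 * a * b * P1 * (\<kappa> - b)"
    proof -
      have "1 + (- b - 2) = - b - 1" by simp
      then have "q * P2 = P1" using q powr_add[of q 1 "- b - 2"] by (simp only: P1_def P2_def) simp
      then have "2 * (b + 1) * q * P2 = 2 * (b + 1) * P1" by simp
      then show ?thesis by (simp only: dim \<kappa>_def) (simp add: algebra_simps)
    qed
    finally have sum: "(\<Sum>i\<in>UNIV. l i) = \<kappa> * exp (\<kappa> * u y) * (laplacian u y + \<kappa> * (norm (grad u y))\<^sup>2)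
        + 4 * a * b * P1 * (\<kappa> - b)"
      by (simp only: add.commute)
    have "\<kappa> * exp (\<kappa> * u y) * (laplacian u y + \<kappa> * (norm (grad u y))\<^sup>2) \<le> 0"
      using scal[of y] inside \<kappa> by (intro mult_nonneg_nonpos) (auto simp: \<kappa>_def)
    moreover have "4 * a * b * P1 * (\<kappa> - b) < 0"
      using a \<kappa> q by (intro mult_pos_neg) (auto simp: P1_def)
    moreover have "(\<Sum>i\<in>UNIV. l i) \<ge> 0" by (intro sum_nonneg l)
    ultimately show False using sum by linarith
  qed
  then show thesis using a by (intro that[of a]) (auto simp: Q_def \<kappa>_def)
qed

text \<open>The decay bound for exp(\<kappa> u) makes the lower limit of u/ln |x| at least
  -2b/\<kappa> for every b > \<kappa>, while that limit is -2\<theta>/c.\<close>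

lemma \<theta>_le: "2 * \<theta> / c \<le> 2"
proof (rule ccontr)
  assume "\<not> ?thesis"
  then have t: "\<theta> / c > 1" by simp
  define \<kappa> where "\<kappa> = real m - 1"
  have \<kappa>: "\<kappa> \<ge> 1" using m by (simp add: \<kappa>_def)
  \<comment> \<open>The midpoint of \<kappa> and \<kappa>\<theta>/c, so that 2b/\<kappa> = 1 +
    \<theta>/c is smaller than 2\<theta>/c.\<close>
  define b where "b = \<kappa> * ((1 + \<theta> / c) / 2)"
  have "b > \<kappa> * 1" unfolding b_def using t \<kappa> by (intro mult_strict_left_mono) auto
  then obtain a where a: "a > 0" "\<And>x. norm x \<ge> R \<Longrightarrow> a * (x \<bullet> x) powr (- b) \<le> exp (\<kappa> * u x)"
    using exp_lower_bound[of b] unfolding \<kappa>_def by auto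
  have "((\<lambda>r::real. (ln a - 2 * b * ln r) / \<kappa> / ln r) \<longlongrightarrow> - (2 * b * inverse \<kappa>)) at_top"
    using \<kappa> by real_asymp
  then have "Liminf at_infinity (\<lambda>x::real^'n. ereal ((ln a - 2 * b * ln (norm x)) / \<kappa> / ln (norm x)))
      = ereal (- (2 * b * inverse \<kappa>))"
    by (intro lim_imp_Liminf trivial_limit_at_infinity tendsto_ereal)
      (rule filterlim_compose[OF _ filterlim_norm_at_top])
  moreover have "Liminf at_infinity (\<lambda>x::real^'n. ereal ((ln a - 2 * b * ln (norm x)) / \<kappa> / ln (norm x)))
      \<le> Liminf at_infinity (\<lambda>x. ereal (u x / ln (norm x)))"
  proof (intro Liminf_mono eventually_at_infinityI)
    fix x :: "real^'n" assume x: "R \<le> norm x"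
    have n: "norm x \<ge> 1" "x \<noteq> 0" using x R by auto
    have "ln (a * (x \<bullet> x) powr (- b)) \<le> ln (exp (\<kappa> * u x))"
      using a n x by (intro ln_mono a(2)) auto
    moreover have "ln (x \<bullet> x) = 2 * ln (norm x)"
      using n by (simp add: ln_realpow flip: power2_norm_eq_inner)
    ultimately have "ln a - 2 * b * ln (norm x) \<le> \<kappa> * u x"
      using a n by (simp add: ln_mult ln_powr)
    then have "(ln a - 2 * b * ln (norm x)) / \<kappa> \<le> u x"
      using \<kappa> by (simp add: pos_divide_le_eq mult.commute)
    moreover have "ln (norm x) \<ge> 0" using n by simp
    ultimately have "(ln a - 2 * b * ln (norm x)) / \<kappa> / ln (norm x) \<le> u x / ln (norm x)"
      by (rule divide_right_mono)
    then show "ereal ((ln a - 2 * b * ln (norm x)) / \<kappa> / ln (norm x)) \<le> ereal (u x / ln (norm x))"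
      by simp
  qed
  ultimately have "ereal (- (2 * b * inverse \<kappa>)) \<le> ereal (- (2 * \<theta> / c))"
    unfolding Liminf_eq by simp
  then have "2 * (\<theta> / c) \<le> 2 * b / \<kappa>" by (simp add: divide_inverse)
  also have "\<dots> = 1 + \<theta> / c" using \<kappa> by (simp add: b_def)
  finally show False using t by simp
qed

end

theorem theorem1p4:
  fixes u :: "real^'n \<Rightarrow> real"
  assumes "CARD('n) \<ge> 4" and "even CARD('n)"
    and "smooth u"
    and "integrable lborel (\<lambda>x. Q_curvature u x * exp (real CARD('n) * u x))"
    and "\<exists>K. compact K \<and> (\<forall>x. x \<notin> K \<longrightarrow> scalar_curvature u x \<ge> 0)"
  shows "(0 \<le> (LINT x|lborel. Q_curvature u x * exp (real CARD('n) * u x)) \<and>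
      (LINT x|lborel. Q_curvature u x * exp (real CARD('n) * u x))
        \<le> fact (CARD('n) - 1) * hypersurface_area (sphere (0 :: (real^'n) \<times> real) 1)) \<and>
    Liminf at_infinity (\<lambda>x. ereal (u x / ln (norm x))) =
      ereal (- (2 / (fact (CARD('n) - 1) * hypersurface_area (sphere (0 :: (real^'n) \<times> real) 1)))
        * (LINT x|lborel. Q_curvature u x * exp (real CARD('n) * u x)))"
proof -
  obtain m where dim: "CARD('n) = 2 * m" using assms(2) by (elim evenE)
  have m: "m \<ge> 2" using assms(1) dim by simp
  have Q: "(\<lambda>x. Q_curvature u x * exp (real CARD('n) * u x)) = (neg_laplacian ^^ m) u"
    using Q_curvature_eq[of u] by (simp add: dim fun_eq_iff)
  obtain K where K: "compact K" "\<And>x. x \<notin> K \<Longrightarrow> scalar_curvature u x \<ge> 0" using assms(5) by blast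
  obtain R0 where R0: "\<And>x. x \<in> K \<Longrightarrow> norm x \<le> R0"
    using compact_imp_bounded[OF K(1)] unfolding bounded_iff by blast
  \<comment> \<open>Adding 1 to R0 places all points with this norm strictly outside K.\<close>
  interpret nonneg_scalar_curvature u m "max 1 (R0 + 1)"
  proof
    show "integrable lborel ((neg_laplacian ^^ m) u)" using assms(4) unfolding Q .
    fix x :: "real^'n" assume "max 1 (R0 + 1) \<le> norm x"
    then have "x \<notin> K" using R0[of x] by auto
    then have "0 \<le> scalar_curvature u x" by (rule K(2))
    moreover have "2 * (real CARD('n) - 1) * exp (- 2 * u x) > 0" using dim m by simp
    ultimately have "0 \<le> - laplacian u x - (real CARD('n) - 2) / 2 * (norm (grad u x))\<^sup>2"
      unfolding scalar_curvature_def by (simp only: zero_le_mult_iff) auto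
    moreover have "(real CARD('n) - 2) / 2 = real m - 1" by (simp add: dim)
    ultimately show "laplacian u x + (real m - 1) * (norm (grad u x))\<^sup>2 \<le> 0" by simp
  qed (use dim m assms(3) in auto)
  define A where "A = (fact (CARD('n) - 1) * hypersurface_area (sphere (0 :: (real^'n) \<times> real) 1) :: real)"
  obtain p where p: "m = Suc p" using m by (cases m) auto
  \<comment> \<open>The sphere lies in the odd dimension 2m + 1. In this closed form the constant is
    visibly the quotient of the denominators of \<theta> and the value of c, because (m + 2)!
    cancels.\<close>
  have A: "A = (4 * pi) ^ m * fact (m - 1)"
  proof -
    define f g :: real where "f = fact (m - 1)" and "g = fact (2 * m - 1)"
    define k l where "k = (real m + 1) * real m" and "l = 2 * real m + 1"
    have pos: "k > 0" "l > 0" "g > 0" using m by (auto simp: k_def l_def g_def)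
    have "hypersurface_area (sphere (0 :: (real^'n) \<times> real) 1)
        = l * ((2 ^ (2 * Suc m) * fact (Suc m)) / fact (2 * Suc m) * pi ^ m)"
      unfolding hypersurface_area_unit_sphere unit_ball_vol_odd[symmetric] by (simp add: dim l_def)
    also have "(fact (2 * Suc m) :: real) = 4 * k * l * g"
      by (simp add: p k_def l_def g_def algebra_simps)
    also have "(fact (Suc m) :: real) = k * f"
      by (simp add: p k_def f_def algebra_simps)
    also have "(2::real) ^ (2 * Suc m) = 4 * 4 ^ m" by (simp add: power_mult)
    finally have "A = g * (l * (4 * 4 ^ m * (k * f) / (4 * k * l * g) * pi ^ m))"
      by (simp add: A_def dim g_def)
    also have "\<dots> = (4 * pi) ^ m * f" using pos by (simp add: power_mult_distrib)
    finally show ?thesis by (simp add: f_def)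
  qed
  have A_pos: "A > 0" by (simp add: A)
  have ratio: "\<theta> / c = total / A"
    by (simp add: \<theta>_def c_def A power_mult_distrib del: fact_Suc)
  have total: "total = (LINT x|lborel. Q_curvature u x * exp (real CARD('n) * u x))"
    unfolding total_def Q ..
  have "total / A \<ge> 0" using \<theta>_nonneg c_pos by (simp flip: ratio)
  then have "0 \<le> total" using A_pos by (simp add: zero_le_divide_iff)
  moreover have "total / A \<le> 1" using \<theta>_le by (simp flip: ratio)
  then have "total \<le> A" using A_pos by simp
  moreover have "2 * \<theta> / c = 2 / A * total" using ratio by (simp flip: times_divide_eq_right)
  then have "Liminf at_infinity (\<lambda>x. ereal (u x / ln (norm x))) = ereal (- (2 / A) * total)"
    using Liminf_eq by simp
  ultimately show ?thesis unfolding total A_def by blast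
qed

end
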